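(* Let $\mathcal O$ be the ring of integers of a number field, let $\Gamma = SL(2,\mathcal O)$, and let $E\subseteq\Gamma$ be the elementary matrix group. Let $\pi\subseteq\mathcal O$ be a nonzero ideal with $\pi\neq(1)$. Then $$[\Gamma:\Gamma(\pi)]=[E:E(\pi)]=N(\pi)^3\prod_{P\mid\pi}\bigl(1-N(P)^{-2}\bigr),$$ where the product is over the set of all prime ideals $P$ of $\mathcal O$ dividing $\pi$.
   Context: Let $\{w_1=1,w_2,\dots,w_n\}$ be an integral basis of $\mathcal O$. The elementary matrix group $E$ is the subgroup of $\Gamma=SL(2,\mathcal O)$ generated by $T_i=\begin{pmatrix}1&w_i\\0&1\end{pmatrix}$ ($1\le i\le n$) and $S=\begin{pmatrix}0&1\\-1&0\end{pmatrix}$. For a nonzero ideal $\pi$ of $\mathcal O$, the principal congruence subgroups are $\Gamma(\pi)=\{(a_{ij})\in\Gamma: a_{11}-1,\,a_{22}-1,\,a_{12},\,a_{21}\in\pi\}$ and $E(\pi)=\{(a_{ij})\in E: a_{11}-1,\,a_{22}-1,\,a_{12},\,a_{21}\in\pi\}$. $N(\cdot)$ denotes the absolute norm of an ideal, $N(\pi)=|\mathcal O/\pi|$. *)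

theory Defs
  imports
    "HOL-Analysis.Determinants"
    "HOL-Algebra.Ideal_Product"
    "HOL-Algebra.QuotRing"
    "HOL-Algebra.Coset"
    "HOL-Algebra.Generated_Groups"
    "HOL-Computational_Algebra.Polynomial"
begin

global_interpretation rat_vs: vector_space "\<lambda>(q :: rat) (x :: 'a :: field_char_0). of_rat q * x"
  by unfold_locales (simp_all add: algebra_simps of_rat_add of_rat_mult)

global_interpretation int_mod: Modules.module "\<lambda>(k :: int) (x :: 'a :: field_char_0). of_int k * x"
  by unfold_locales (simp_all add: algebra_simps)

text \<open>The type \<open>'a\<close> as a whole is the number field: finite-dimensional over its prime field, which
  is the range of \<^const>\<open>of_rat\<close>.\<close>

definition number_field :: "'a :: field_char_0 itself \<Rightarrow> bool" where
  "number_field _ \<longleftrightarrow> (\<exists>B :: 'a set. finite B \<and> rat_vs.span B = UNIV)"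

text \<open>The definitions below make sense for every field of characteristic zero; they are only
  meant under the hypothesis \<^const>\<open>number_field\<close>.\<close>

definition ring_of_integers :: "'a :: field_char_0 ring" where
  "ring_of_integers =
     \<lparr>carrier = {x. algebraic_int x}, mult = (*), one = 1, zero = 0, add = (+)\<rparr>"

definition integral_basis :: "'a :: field_char_0 set \<Rightarrow> bool" where
  "integral_basis W \<longleftrightarrow> finite W \<and> int_mod.independent W \<and>
     int_mod.span W = carrier (ring_of_integers :: 'a ring)"

definition ideal_norm :: "'a :: field_char_0 set \<Rightarrow> nat" where
  "ideal_norm I = card (carrier (ring_of_integers Quot I))"

definition ideal_dvd :: "'a :: field_char_0 set \<Rightarrow> 'a set \<Rightarrow> bool" where
  "ideal_dvd I J \<longleftrightarrow>
     (\<exists>K. ideal K ring_of_integers \<and> J = ideal_prod ring_of_integers I K)"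

definition SL2_integers :: "('a :: field_char_0 ^ 2 ^ 2) monoid" where
  "SL2_integers =
     \<lparr>carrier = {A. (\<forall>i j. A $ i $ j \<in> carrier ring_of_integers) \<and> det A = 1},
      mult = (**), one = mat 1\<rparr>"

definition T_mat :: "'a :: field_char_0 \<Rightarrow> 'a ^ 2 ^ 2" where
  "T_mat w = vector [vector [1, w], vector [0, 1]]"

definition S_mat :: "'a :: field_char_0 ^ 2 ^ 2" where
  "S_mat = vector [vector [0, 1], vector [-1, 0]]"

definition elementary_group :: "'a :: field_char_0 set \<Rightarrow> ('a ^ 2 ^ 2) monoid" where
  "elementary_group W =
     SL2_integers\<lparr>carrier := generate SL2_integers (insert S_mat (T_mat ` W))\<rparr>"

definition congruence_subgroup ::
    "('a :: field_char_0 ^ 2 ^ 2) monoid \<Rightarrow> 'a set \<Rightarrow> ('a ^ 2 ^ 2) set" where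
  "congruence_subgroup G I =
     {A \<in> carrier G. A $ 1 $ 1 - 1 \<in> I \<and> A $ 2 $ 2 - 1 \<in> I \<and> A $ 1 $ 2 \<in> I \<and> A $ 2 $ 1 \<in> I}"

text \<open>The value is \<open>0\<close> when the index is infinite, since \<^const>\<open>card\<close> is.\<close>

definition group_index :: "('b, 'c) monoid_scheme \<Rightarrow> 'b set \<Rightarrow> nat" where
  "group_index G H = card (rcosets\<^bsub>G\<^esub> H)"

end

theory Submission
  imports Defs
begin

text \<open>
  Both indices count the classes modulo \<open>\<pi>\<close> of the matrices in the respective group. Since \<open>\<O>/\<pi>\<close>
  is finite, it has stable rank one, so that every matrix of determinant \<open>1\<close> over it is a product of
  elementary ones; as the \<open>T\<close>-matrices of an integral basis generate all of them, already \<open>E\<close> surjects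
  onto \<open>SL(2, \<O>/\<pi>)\<close>. A unimodular first row extends to such a matrix in \<open>N(\<pi>)\<close> ways, and a row is
  unimodular iff it does not vanish modulo any prime \<open>P \<supseteq> \<pi>\<close>; by the Chinese remainder theorem these
  conditions are independent, and each has density \<open>1 - N(P)\<^sup>-\<^sup>2\<close>. The primes containing \<open>\<pi>\<close> are the
  primes dividing \<open>\<pi>\<close>, because nonzero primes of \<open>\<O>\<close> are invertible.
\<close>

section \<open>Residues modulo ideals of the ring of integers\<close>

text \<open>Maps with the same fibres on \<open>A\<close> have equally large images, via
  \<open>f x \<mapsto> g x\<close>. This trades sets of cosets for sets of representatives or
  residues.\<close>

lemma card_image_eqI:
  assumes "\<And>x y. x \<in> A \<Longrightarrow> y \<in> A \<Longrightarrow> f x = f y \<longleftrightarrow> g x = g y"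
  shows "card (f ` A) = card (g ` A)"
proof -
  define h where "h z = g (inv_into A f z)" for z
  have h: "h (f x) = g x" if "x \<in> A" for x
    unfolding h_def using that assms[of "inv_into A f (f x)" x]
    by (simp add: f_inv_into_f inv_into_into)
  have "inj_on h (f ` A)"
    using h assms by (auto simp: inj_on_def)
  moreover have "h ` f ` A = g ` A"
    using h by (force simp: image_iff)
  ultimately show ?thesis
    using card_image by metis
qed

lemma ring_of_integers_simps [simp]:
  "carrier ring_of_integers = {x. algebraic_int x}"
  "mult ring_of_integers = (*)" "add ring_of_integers = (+)"
  "one ring_of_integers = 1" "zero ring_of_integers = 0"
  by (simp_all add: ring_of_integers_def)

text \<open>Residue classes are encoded by elements of the field itself, so that arithmetic and
  ideal membership apply to them directly. Congruent \<open>x\<close> give equivalent predicates, so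
  \<open>SOME\<close> picks one common representative per class.\<close>

definition rep :: "'a :: field_char_0 set \<Rightarrow> 'a \<Rightarrow> 'a" where
  "rep I x = (SOME y. algebraic_int y \<and> y - x \<in> I)"

definition reps :: "'a :: field_char_0 set \<Rightarrow> 'a set" where
  "reps I = rep I ` {x. algebraic_int x}"

text \<open>Closure of the algebraic integers under addition and multiplication is the assumption
  \<open>ring\<close>; in the theorem it comes out of the assumption that \<open>\<pi>\<close> is an
  ideal of a ring.\<close>

locale number_ring =
  fixes W :: "'a :: field_char_0 set"
  assumes basis: "integral_basis W"
    and ring: "ring (ring_of_integers :: 'a ring)"
begin

abbreviation R :: "'a ring" where "R \<equiv> ring_of_integers"

lemma algebraic_int_add [simp, intro]:
  "algebraic_int (x :: 'a) \<Longrightarrow> algebraic_int y \<Longrightarrow> algebraic_int (x + y)"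
  using abelian_monoid.a_closed[OF abelian_group.axioms(1)[OF ring.axioms(1)[OF ring]], of x y] by simp

lemma algebraic_int_mult [simp, intro]:
  "algebraic_int (x :: 'a) \<Longrightarrow> algebraic_int y \<Longrightarrow> algebraic_int (x * y)"
  using monoid.m_closed[OF ring.axioms(2)[OF ring], of x y] by simp

lemma algebraic_int_diff [simp, intro]:
  "algebraic_int (x :: 'a) \<Longrightarrow> algebraic_int y \<Longrightarrow> algebraic_int (x - y)"
  using algebraic_int_add[of x "- y"] by simp

lemma algebraic_int_1 [simp, intro]: "algebraic_int (1 :: 'a)"
  by (simp add: int_imp_algebraic_int)

lemma algebraic_int_power [simp, intro]: "algebraic_int (x :: 'a) \<Longrightarrow> algebraic_int (x ^ n)"
  by (induction n) auto

lemma algebraic_int_sum [intro]: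
  "(\<And>x. x \<in> A \<Longrightarrow> algebraic_int (f x :: 'a)) \<Longrightarrow> algebraic_int (sum f A)"
  by (induction A rule: infinite_finite_induct) auto

lemma algebraic_int_prod [intro]:
  "(\<And>x. x \<in> A \<Longrightarrow> algebraic_int (f x :: 'a)) \<Longrightarrow> algebraic_int (prod f A)"
  by (induction A rule: infinite_finite_induct) auto

section \<open>Ideals of the ring of integers\<close>

lemma ring_of_integers_cring: "cring R"
  by (intro cring.intro comm_monoid.intro comm_monoid_axioms.intro ring ring.axioms(2)) auto

lemma ideal_algebraic_int: "ideal I R \<Longrightarrow> x \<in> I \<Longrightarrow> algebraic_int x"
  using additive_subgroup.a_subset[OF ideal.axioms(1), of I R] by auto

lemma ideal_0: "ideal I R \<Longrightarrow> 0 \<in> I"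
  using additive_subgroup.zero_closed[OF ideal.axioms(1), of I R] by simp

lemma ideal_add: "ideal I R \<Longrightarrow> x \<in> I \<Longrightarrow> y \<in> I \<Longrightarrow> x + y \<in> I"
  using additive_subgroup.a_closed[OF ideal.axioms(1), of I R x y] by simp

lemma ideal_mult: "ideal I R \<Longrightarrow> algebraic_int x \<Longrightarrow> y \<in> I \<Longrightarrow> x * y \<in> I"
  using ideal.I_l_closed[of I R y x] by simp

lemma ideal_mult': "ideal I R \<Longrightarrow> algebraic_int x \<Longrightarrow> y \<in> I \<Longrightarrow> y * x \<in> I"
  using ideal.I_r_closed[of I R y x] by simp

lemma ideal_uminus: "ideal I R \<Longrightarrow> x \<in> I \<Longrightarrow> - x \<in> I"
  using ideal_mult[of I "-1" x] by simp

lemma ideal_uminus_iff: "ideal I R \<Longrightarrow> - x \<in> I \<longleftrightarrow> x \<in> I"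
  using ideal_uminus by (metis minus_minus)

lemma ideal_diff: "ideal I R \<Longrightarrow> x \<in> I \<Longrightarrow> y \<in> I \<Longrightarrow> x - y \<in> I"
  using ideal_add[of I x "- y"] ideal_uminus by simp

lemma ideal_lincomb:
  assumes "ideal I R" and "algebraic_int x" "algebraic_int y" "algebraic_int z"
    and "u \<in> I" "v \<in> I" "w \<in> I"
  shows "x * u + y * v + z * w \<in> I"
  using assms ideal_add ideal_mult by metis

lemma idealI_integers:
  assumes "\<And>x. x \<in> I \<Longrightarrow> algebraic_int x" and "0 \<in> I"
    and "\<And>x y. x \<in> I \<Longrightarrow> y \<in> I \<Longrightarrow> x + y \<in> I"
    and mult: "\<And>x y. algebraic_int x \<Longrightarrow> y \<in> I \<Longrightarrow> x * y \<in> I"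
  shows "ideal I R"
proof (rule idealI[OF ring])
  have neg: "- x \<in> I" if "x \<in> I" for x
    using mult[of "-1" x] that by simp
  have inv: "inv\<^bsub>add_monoid R\<^esub> x = - x" if "x \<in> I" for x
    by (rule group.inv_equality[OF abelian_group.a_group[OF ring.axioms(1)[OF ring]]])
      (use that assms(1) in auto)
  show "subgroup I (add_monoid R)"
  proof (rule subgroup.intro)
    show "inv\<^bsub>add_monoid R\<^esub> x \<in> I" if "x \<in> I" for x
      unfolding inv[OF that] using neg[OF that] .
  qed (use assms in auto)
next
  show "x \<otimes>\<^bsub>R\<^esub> a \<in> I" "a \<otimes>\<^bsub>R\<^esub> x \<in> I" if "a \<in> I" "x \<in> carrier R" for a x
    using mult[of x a] that by (simp_all add: mult.commute)
qed

lemma ideal_eq_carrier_iff: "ideal I R \<Longrightarrow> I = carrier R \<longleftrightarrow> 1 \<in> I"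
  using ideal_mult'[of I _ 1] ideal_algebraic_int[of I] by auto

section \<open>Representatives of residue classes\<close>

lemma
  assumes "ideal I R" and "algebraic_int x"
  shows algebraic_int_rep [simp, intro]: "algebraic_int (rep I x)"
    and rep_diff: "rep I x - x \<in> I"
proof -
  have "algebraic_int x \<and> x - x \<in> I"
    using assms ideal_0 by simp
  then have "algebraic_int (rep I x) \<and> rep I x - x \<in> I"
    unfolding rep_def by (rule someI)
  then show "algebraic_int (rep I x)" "rep I x - x \<in> I" by auto
qed

lemma diff_mem_ideal_cong:
  assumes I: "ideal I R" and *: "x - y \<in> I"
  shows "z - x \<in> I \<longleftrightarrow> z - y \<in> I"
  using ideal_add[OF I _ *, of "z - x"] ideal_diff[OF I _ *, of "z - y"] by auto

lemma rep_eq_iff: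
  assumes I: "ideal I R" and x: "algebraic_int x" and y: "algebraic_int y"
  shows "rep I x = rep I y \<longleftrightarrow> x - y \<in> I"
proof
  assume "rep I x = rep I y"
  then show "x - y \<in> I"
    using ideal_diff[OF I rep_diff[OF I y] rep_diff[OF I x]] by simp
next
  assume *: "x - y \<in> I"
  show "rep I x = rep I y"
    by (simp add: rep_def diff_mem_ideal_cong[OF I *])
qed

lemma reps_algebraic_int: "ideal I R \<Longrightarrow> x \<in> reps I \<Longrightarrow> algebraic_int x"
  by (auto simp: reps_def)

lemma rep_in_reps: "algebraic_int x \<Longrightarrow> rep I x \<in> reps I"
  by (auto simp: reps_def)

lemma rep_reps: "ideal I R \<Longrightarrow> x \<in> reps I \<Longrightarrow> rep I x = x"
  unfolding reps_def using rep_eq_iff[of I "rep I y" y for y] rep_diff[of I] by auto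

lemma reps_eqI: "ideal I R \<Longrightarrow> x \<in> reps I \<Longrightarrow> y \<in> reps I \<Longrightarrow> x - y \<in> I \<Longrightarrow> x = y"
  using rep_eq_iff[of I x y] by (simp add: rep_reps reps_algebraic_int)

lemma ideal_norm_eq:
  assumes I: "ideal I R"
  shows "ideal_norm I = card (reps I)"
proof -
  have coset: "I +>\<^bsub>R\<^esub> x = {z. z - x \<in> I}" for x
  proof (intro Set.set_eqI iffI)
    fix z assume "z \<in> {z. z - x \<in> I}"
    then have "\<exists>h\<in>I. z = h + x"
      by (intro bexI[of _ "z - x"]) auto
    then show "z \<in> I +>\<^bsub>R\<^esub> x"
      unfolding a_r_coset_def' ring_of_integers_simps by simp
  next
    fix z assume "z \<in> I +>\<^bsub>R\<^esub> x"
    then obtain h where "h \<in> I" "z = h + x"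
      unfolding a_r_coset_def' ring_of_integers_simps by blast
    then show "z \<in> {z. z - x \<in> I}" by simp
  qed
  have "carrier (R Quot I) = (\<lambda>x. {z. z - x \<in> I}) ` {x. algebraic_int x}"
    by (simp add: FactRing_def A_RCOSETS_def' coset UNION_singleton_eq_range)
  also have "card \<dots> = card (reps I)"
    unfolding reps_def
  proof (rule card_image_eqI)
    fix x y :: 'a assume x: "x \<in> {x. algebraic_int x}" and y: "y \<in> {x. algebraic_int x}"
    have "{z. z - x \<in> I} = {z. z - y \<in> I} \<longleftrightarrow> x - y \<in> I"
    proof
      assume eq: "{z. z - x \<in> I} = {z. z - y \<in> I}"
      have "x \<in> {z. z - x \<in> I}" using ideal_0[OF I] by simp
      then have "x \<in> {z. z - y \<in> I}" unfolding eq .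
      then show "x - y \<in> I" by simp
    next
      assume *: "x - y \<in> I"
      show "{z. z - x \<in> I} = {z. z - y \<in> I}"
        by (rule Collect_cong) (rule diff_mem_ideal_cong[OF I *])
    qed
    then show "{z. z - x \<in> I} = {z. z - y \<in> I} \<longleftrightarrow> rep I x = rep I y"
      using x y by (simp add: rep_eq_iff[OF I])
  qed
  finally show ?thesis by (simp add: ideal_norm_def)
qed

section \<open>Finiteness of the residue rings\<close>

text \<open>If an integer polynomial with nonzero constant term vanishes at
  \<open>a \<in> I\<close>, then that constant term is minus a multiple of \<open>a\<close>, hence
  lies in \<open>I\<close>.\<close>

lemma ideal_contains_integer:
  assumes I: "ideal I R" and "I \<noteq> {0}"
  obtains m :: int where "m > 0" and "of_int m \<in> I"
proof -
  obtain a where a: "a \<in> I" "a \<noteq> 0"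
    using assms ideal_0 by blast
  \<comment> \<open>Factors of the variable are stripped off until the constant term is nonzero;
    this keeps the root because \<open>a \<noteq> 0\<close>.\<close>
  have int: "\<exists>q. poly q a = 0 \<and> (\<forall>i. coeff q i \<in> \<int>) \<and> coeff q 0 \<noteq> 0"
    if "poly p a = 0" "\<forall>i. coeff p i \<in> \<int>" "p \<noteq> 0" for p
    using that
  proof (induction p)
    case (pCons c p)
    show ?case
    proof (cases "c = 0")
      case True
      have "\<forall>i. coeff p i \<in> \<int>"
        using pCons.prems(2) by (metis coeff_pCons_Suc)
      then show ?thesis
        using pCons True a by auto
    next
      case False
      then show ?thesis using pCons.prems by (metis coeff_pCons_0)
    qed
  qed simp
  have "algebraic_int a" using ideal_algebraic_int[OF I a(1)] .
  then obtain p where "poly p a = 0" "\<forall>i. coeff p i \<in> \<int>" "lead_coeff p = 1"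
    by (auto simp: algebraic_int.simps)
  then obtain q where q: "poly q a = 0" "\<And>i. coeff q i \<in> \<int>" "coeff q 0 \<noteq> 0"
    using int[of p] by force
  obtain c r where cr: "q = pCons c r" by (cases q)
  have "\<And>i. coeff r i \<in> \<int>" using q(2) cr by (metis coeff_pCons_Suc)
  then have "algebraic_int (poly r a)"
    unfolding poly_altdef using \<open>algebraic_int a\<close>
    by (intro algebraic_int_sum algebraic_int_mult algebraic_int_power) (simp_all add: int_imp_algebraic_int)
  then have "a * poly r a \<in> I"
    by (rule ideal_mult'[OF I _ a(1)])
  moreover have "c = - (a * poly r a)"
    using q(1) cr by (simp add: eq_neg_iff_add_eq_0)
  ultimately have c: "c \<in> I" "c \<noteq> 0" "c \<in> \<int>"
    using ideal_uminus[OF I] q(2)[of 0] q(3) cr by auto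
  then obtain k where k: "c = of_int k" by (auto elim: Ints_cases)
  show thesis
  proof (rule that[of "\<bar>k\<bar>"])
    show "of_int \<bar>k\<bar> \<in> I"
      using c(1) k ideal_uminus[OF I c(1)] by (cases "k \<ge> 0") auto
  qed (use c k in auto)
qed

text \<open>A positive integer \<open>m\<close> in \<open>I\<close> allows the coordinates with
  respect to the integral basis to be reduced modulo \<open>m\<close>, which leaves finitely many
  coordinate vectors.\<close>

lemma finite_reps:
  assumes I: "ideal I R" and "I \<noteq> {0}"
  shows "finite (reps I)"
proof -
  obtain m where m: "m > 0" "of_int m \<in> I"
    using ideal_contains_integer[OF assms] .
  have W: "finite W" "int_mod.span W = {x. algebraic_int x}"
    using basis by (auto simp: integral_basis_def)
  have Wint: "algebraic_int w" if "w \<in> W" for w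
    using that W int_mod.span_base by auto
  define F where "F u = (\<Sum>w\<in>W. of_int (u w) * w)" for u
  have Fint: "algebraic_int (F u)" for u
    unfolding F_def using Wint by (intro algebraic_int_sum) auto
  have "reps I \<subseteq> (\<lambda>u. rep I (F u)) ` (W \<rightarrow>\<^sub>E {0..<m})"
  proof
    fix z assume "z \<in> reps I"
    then obtain x where x: "algebraic_int x" "z = rep I x" by (auto simp: reps_def)
    then have "x \<in> int_mod.span W" using W by simp
    then obtain u where u: "x = F u"
      unfolding F_def int_mod.span_finite[OF W(1)] by auto
    let ?v = "restrict (\<lambda>w. u w mod m) W"
    have "F u - F ?v = of_int m * F (\<lambda>w. u w div m)"
      unfolding F_def sum_distrib_left sum_subtractf[symmetric]
    proof (intro sum.cong refl)
      fix w assume "w \<in> W"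
      have "(of_int (u w) :: 'a) = of_int (m * (u w div m) + u w mod m)"
        by simp
      then have *: "(of_int (u w) :: 'a) = of_int m * of_int (u w div m) + of_int (u w mod m)"
        by (simp only: of_int_add of_int_mult)
      show "of_int (u w) * w - of_int (?v w) * w = of_int m * (of_int (u w div m) * w)"
        using \<open>w \<in> W\<close> by (simp add: * algebra_simps)
    qed
    then have "F u - F ?v \<in> I"
      using ideal_mult'[OF I Fint m(2)] by simp
    then have "z = rep I (F ?v)"
      using x u by (simp add: rep_eq_iff[OF I Fint Fint])
    moreover have "?v \<in> W \<rightarrow>\<^sub>E {0..<m}" using m by auto
    ultimately show "z \<in> (\<lambda>u. rep I (F u)) ` (W \<rightarrow>\<^sub>E {0..<m})" by blast
  qed
  then show ?thesis
    by (rule finite_subset) (intro finite_imageI finite_PiE, use W in auto)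
qed

text \<open>Applied to the powers of an element, this yields inverses modulo primes; applied to
  \<open>m * g ^ n\<close>, it yields integrality of \<open>g\<close>.\<close>

lemma power_pigeonhole:
  assumes I: "ideal I R" and "I \<noteq> {0}" and f: "\<And>n. algebraic_int (f n)"
  obtains i j :: nat where "i < j" and "f j - f i \<in> I"
proof -
  have "range (\<lambda>n. rep I (f n)) \<subseteq> reps I"
    using f by (auto intro: rep_in_reps)
  then have "\<not> inj (\<lambda>n. rep I (f n))"
    using finite_reps[OF assms(1,2)] finite_imageD finite_subset infinite_UNIV_nat by blast
  then obtain i j where ij: "i \<noteq> j" "rep I (f i) = rep I (f j)"
    by (auto simp: inj_on_def)
  then have "f j - f i \<in> I" "f i - f j \<in> I"
    using f rep_eq_iff[OF I] ij(2) ij(2)[symmetric] by blast+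
  then show thesis
    using ij(1) that[of i j] that[of j i] by linarith
qed

section \<open>Arithmetic modulo prime ideals\<close>

lemma prime_ideal_mult_iff:
  assumes "primeideal P R" and "algebraic_int x" and "algebraic_int y"
  shows "x * y \<in> P \<longleftrightarrow> x \<in> P \<or> y \<in> P"
proof -
  interpret primeideal P R by fact
  show ?thesis
    using I_prime[of x y] ideal_mult[OF is_ideal] ideal_mult'[OF is_ideal] assms(2,3) by auto
qed

lemma prime_ideal_one: "primeideal P R \<Longrightarrow> 1 \<notin> P"
  using ideal_eq_carrier_iff primeideal.axioms(1) primeideal.I_notcarr by metis

lemma prime_ideal_power:
  assumes P: "primeideal P R" and x: "algebraic_int x" and "x ^ n \<in> P"
  shows "x \<in> P"
  using assms(3) by (induction n) (use x P prime_ideal_one prime_ideal_mult_iff in auto)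

text \<open>A finite integral domain is a field: two powers of \<open>x\<close> agree modulo
  \<open>P\<close>, and the smaller one can be cancelled since \<open>P\<close> is prime.\<close>

lemma prime_ideal_inverse:
  assumes P: "primeideal P R" and "P \<noteq> {0}" and x: "algebraic_int x" "x \<notin> P"
  obtains y where "algebraic_int y" and "x * y - 1 \<in> P"
proof -
  obtain i j where ij: "i < j" "x ^ j - x ^ i \<in> P"
    using power_pigeonhole[OF primeideal.axioms(1)[OF P] assms(2), of "\<lambda>n. x ^ n"] x by auto
  have "x ^ j = x ^ i * (x * x ^ (j - i - 1))"
    using ij(1) by (simp flip: power_add power_Suc)
  then have "x ^ i * (x * x ^ (j - i - 1) - 1) \<in> P"
    using ij(2) by (simp add: algebra_simps)
  then have "x * x ^ (j - i - 1) - 1 \<in> P"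
    using prime_ideal_power[OF P x(1), of i] x by (subst (asm) prime_ideal_mult_iff[OF P]) auto
  then show thesis using that x by blast
qed

end

section \<open>Primes containing an ideal divide it\<close>

context number_ring
begin

lemma prime_ideal_prod:
  assumes P: "primeideal P R" and "finite A"
    and f: "\<And>x. x \<in> A \<Longrightarrow> algebraic_int (f x)" "\<And>x. x \<in> A \<Longrightarrow> f x \<notin> P"
  shows "prod f A \<notin> P"
  using assms(2) f
proof (induction A)
  case empty
  then show ?case using prime_ideal_one[OF P] by simp
next
  case (insert a A)
  then have "algebraic_int (prod f A)" by (intro algebraic_int_prod) auto
  then show ?case using insert by (simp add: prime_ideal_mult_iff[OF P])
qed

text \<open>An element \<open>b\<close> is good if it is nonzero in the localization of \<open>\<O>/I\<close> at \<open>P\<close>. If the ideal of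
  \<open>\<O>/I\<close> generated by a good \<open>b\<close> is as small as possible, then no multiple \<open>b * x\<close> with \<open>x \<in> P\<close> is good;
  multiplying \<open>b\<close> by witnesses of this for all classes in \<open>P/I\<close> yields the annihilator.\<close>

lemma prime_ideal_annihilator:
  assumes P: "primeideal P R" and I: "ideal I R" "I \<noteq> {0}" and "I \<subseteq> P"
  obtains b where "algebraic_int b" and "b \<notin> I" and "\<And>x. x \<in> P \<Longrightarrow> b * x \<in> I"
proof -
  note P_ideal = primeideal.axioms(1)[OF P]
  have P_int: "\<And>x. x \<in> P \<Longrightarrow> algebraic_int x" using ideal_algebraic_int[OF P_ideal] .
  define good where
    "good b \<longleftrightarrow> algebraic_int b \<and> (\<forall>s. algebraic_int s \<longrightarrow> b * s \<in> I \<longrightarrow> s \<in> P)" for b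
  define img where "img b = (\<lambda>r. rep I (b * r)) ` {r. algebraic_int r}" for b
  have "good 1" using \<open>I \<subseteq> P\<close> by (auto simp: good_def)
  then obtain b where b: "good b" and min: "\<And>c. good c \<Longrightarrow> card (img b) \<le> card (img c)"
    using ex_has_least_nat[of good 1 "\<lambda>b. card (img b)"] by blast
  have b_int: "algebraic_int b" using b by (simp add: good_def)
  have fin: "finite (img b)"
    by (rule finite_subset[OF _ finite_reps[OF I]]) (use b_int in \<open>auto simp: img_def intro!: rep_in_reps\<close>)
  have "\<not> good (b * x)" if x: "x \<in> P" for x
  proof
    assume good: "good (b * x)"
    have x_int: "algebraic_int x" using P_int[OF x] .
    have "img (b * x) \<subseteq> img b"
    proof
      fix y assume "y \<in> img (b * x)"
      then obtain r where "algebraic_int r" "y = rep I (b * (x * r))"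
        by (auto simp: img_def mult.assoc)
      then show "y \<in> img b" using x_int by (auto simp: img_def)
    qed
    \<comment> \<open>By minimality the inclusion is an equality, so \<open>b\<close> itself is a
      multiple of \<open>b * x\<close> modulo \<open>I\<close>.\<close>
    then have "img (b * x) = img b"
      using card_seteq[OF fin] min[OF good] by blast
    moreover have "rep I b \<in> img b"
      by (auto simp: img_def intro!: image_eqI[of _ _ 1])
    ultimately obtain r where r: "algebraic_int r" "rep I b = rep I (b * x * r)"
      by (auto simp: img_def)
    then have "b - b * x * r \<in> I"
      using rep_eq_iff[OF I(1)] b_int x_int by simp
    then have "b * (1 - x * r) \<in> I" by (simp add: algebra_simps)
    then have "1 - x * r \<in> P" using b r x_int by (simp add: good_def)
    then have "1 \<in> P"
      using ideal_add[OF P_ideal _ ideal_mult'[OF P_ideal r(1) x], of "1 - x * r"] by simp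
    then show False using prime_ideal_one[OF P] by simp
  qed
  then have "\<exists>s. algebraic_int s \<and> s \<notin> P \<and> b * x * s \<in> I" if "x \<in> P" for x
    using that P_int[OF that] b_int by (auto simp: good_def)
  then obtain s where s: "\<And>x. x \<in> P \<Longrightarrow> algebraic_int (s x)" "\<And>x. x \<in> P \<Longrightarrow> s x \<notin> P"
    "\<And>x. x \<in> P \<Longrightarrow> b * x * s x \<in> I" by metis
  \<comment> \<open>One witness per class suffices: \<open>I \<subseteq> P\<close>, so the
    representative of an \<open>x \<in> P\<close> stays in \<open>P\<close>, and
    \<open>c * x\<close> modulo \<open>I\<close> depends only on the class of
    \<open>x\<close>.\<close>
  define A where "A = reps I \<inter> P"
  have A: "finite A" using finite_reps[OF I] by (simp add: A_def)
  define c where "c = b * prod s A"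
  have prod_int: "algebraic_int (prod s A)" using s(1) by (intro algebraic_int_prod) (auto simp: A_def)
  show thesis
  proof (rule that[of c])
    show c_int: "algebraic_int c" using prod_int b_int by (simp add: c_def)
    show "c \<notin> I"
      using b prod_int prime_ideal_prod[OF P A, of s] s by (auto simp: c_def A_def good_def)
    show "c * x \<in> I" if x: "x \<in> P" for x
    proof -
      let ?x = "rep I x"
      have d: "?x - x \<in> I" using rep_diff[OF I(1) P_int[OF x]] .
      have "?x \<in> P" using ideal_add[OF P_ideal _ x, of "?x - x"] d \<open>I \<subseteq> P\<close> by auto
      then have mem: "?x \<in> A" using rep_in_reps[OF P_int[OF x]] by (simp add: A_def)
      have "algebraic_int (prod s (A - {?x}))"
        using s(1) by (intro algebraic_int_prod) (auto simp: A_def)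
      then have "b * ?x * s ?x * prod s (A - {?x}) \<in> I"
        using ideal_mult'[OF I(1) _ s(3)[OF \<open>?x \<in> P\<close>]] by blast
      also have "b * ?x * s ?x * prod s (A - {?x}) = c * ?x"
        using prod.remove[OF A mem, of s] by (simp add: c_def mult_ac)
      finally show ?thesis
        using ideal_diff[OF I(1) _ ideal_mult[OF I(1) c_int d], of "c * ?x"]
        by (simp add: algebra_simps)
    qed
  qed
qed

lemma principal_ideal:
  assumes "algebraic_int (m :: 'a)"
  shows "ideal ((*) m ` {x. algebraic_int x}) R" (is "ideal ?I R")
proof (rule idealI_integers)
  show "x + y \<in> ?I" if "x \<in> ?I" "y \<in> ?I" for x y
    using that by (auto simp flip: distrib_left)
  show "x * y \<in> ?I" if "algebraic_int x" "y \<in> ?I" for x y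
    using that by (auto simp: mult.left_commute[of x])
qed (use assms in auto)

lemma principal_ideal_nonzero:
  assumes "m \<noteq> (0 :: 'a)"
  shows "(*) m ` {x. algebraic_int x} \<noteq> {0}"
proof -
  have "m * 1 \<in> (*) m ` {x. algebraic_int x}" by blast
  then show ?thesis using assms by auto
qed

text \<open>By pigeonhole, some \<open>g ^ j - g ^ i\<close> is integral; this makes \<open>g\<close> a root of a monic polynomial minus
  an algebraic integer, and no Cayley--Hamilton argument is needed.\<close>

lemma almost_integral_imp_algebraic_int:
  assumes "m \<noteq> 0" and "algebraic_int m" and int: "\<And>n. algebraic_int (m * g ^ n)"
  shows "algebraic_int (g :: 'a)"
proof -
  let ?I = "(*) m ` {x. algebraic_int x}"
  note I = principal_ideal[OF assms(2)] principal_ideal_nonzero[OF assms(1)]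
  then obtain i j where ij: "i < j" "m * g ^ j - m * g ^ i \<in> ?I"
    using power_pigeonhole[OF I, of "\<lambda>n. m * g ^ n"] int by blast
  then have y: "algebraic_int (g ^ j - g ^ i)"
    using \<open>m \<noteq> 0\<close> by (auto simp flip: right_diff_distrib)
  let ?p = "monom 1 j - monom 1 i :: 'a poly"
  have deg: "degree ?p = j"
    using degree_add_eq_left[of "- monom 1 i" "monom 1 j :: 'a poly"] ij(1)
    by (simp add: degree_monom_eq)
  show ?thesis
  proof (rule algebraic_int_root[OF y, of ?p])
    show "lead_coeff ?p = 1" unfolding deg using ij(1) by simp
  qed (use ij(1) deg in \<open>auto simp: poly_monom\<close>)
qed

text \<open>The classical inversion of a prime: a fraction \<open>g\<close> outside the ring of
  integers with \<open>g P\<close> integral cannot map \<open>P\<close> into itself, which forces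
  \<open>P + g P\<close> to be the whole ring.\<close>

lemma prime_ideal_dvd:
  assumes P: "primeideal P R" and I: "ideal I R" "I \<noteq> {0}" and "I \<subseteq> P"
  shows "ideal_dvd P I"
proof -
  note P_ideal = primeideal.axioms(1)[OF P]
  have P_int: "\<And>x. x \<in> P \<Longrightarrow> algebraic_int x" using ideal_algebraic_int[OF P_ideal] .
  have "P \<noteq> {0}" using assms ideal_0[OF I(1)] by auto
  obtain k where k: "k > 0" "of_int k \<in> P"
    using ideal_contains_integer[OF P_ideal \<open>P \<noteq> {0}\<close>] .
  define m where "m = (of_int k :: 'a)"
  have m: "m \<noteq> 0" "m \<in> P" using k by (auto simp: m_def)
  let ?M = "(*) m ` {x. algebraic_int x}"
  have M: "ideal ?M R" "?M \<noteq> {0}"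
    using principal_ideal[OF P_int[OF m(2)]] principal_ideal_nonzero[OF m(1)] .
  have "?M \<subseteq> P" using ideal_mult'[OF P_ideal _ m(2)] by auto
  \<comment> \<open>\<open>b\<close> kills \<open>P\<close> modulo the principal ideal of
    \<open>m\<close> without lying in it, so \<open>b / m\<close> is not integral but multiplies
    \<open>P\<close> into the integers.\<close>
  then obtain b where b: "algebraic_int b" "b \<notin> ?M" "\<And>x. x \<in> P \<Longrightarrow> b * x \<in> ?M"
    using prime_ideal_annihilator[OF P M] by blast
  define g where "g = b / m"
  have g: "\<not> algebraic_int g"
  proof
    assume "algebraic_int g"
    moreover have "b = m * g" using m by (simp add: g_def)
    ultimately show False using b(2) by blast
  qed
  have gP: "algebraic_int (g * x)" if "x \<in> P" for x
    using b(3)[OF that] m(1) by (auto simp: g_def)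
  \<comment> \<open>Otherwise all \<open>m * g ^ n\<close> would lie in \<open>P\<close>, so
    \<open>g\<close> would be almost integral and hence integral.\<close>
  have "\<exists>p\<in>P. g * p \<notin> P"
  proof (rule ccontr)
    assume "\<not> ?thesis"
    then have closed: "g * p \<in> P" if "p \<in> P" for p using that by blast
    have "m * g ^ n \<in> P" for n
      by (induction n) (use m closed in \<open>auto simp: mult.left_commute\<close>)
    then show False
      using almost_integral_imp_algebraic_int[of m g] m(1) P_int[OF m(2)] P_int g by blast
  qed
  then obtain p where p: "p \<in> P" "g * p \<notin> P" by blast
  obtain y where y: "algebraic_int y" "g * p * y - 1 \<in> P"
    using prime_ideal_inverse[OF P \<open>P \<noteq> {0}\<close> gP[OF p(1)] p(2)] .
  \<comment> \<open>\<open>P + g P = \<O>\<close>, so \<open>\<O> + g \<O>\<close> serves as the inverse of \<open>P\<close>, and \<open>K\<close> is its product with \<open>I\<close>.\<close>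
  define K where "K = (\<lambda>(u, v). u + g * v) ` (I \<times> I)"
  have KI: "u + g * v \<in> K" if "u \<in> I" "v \<in> I" for u v
    using that by (auto simp: K_def)
  have K: "ideal K R"
  proof (rule idealI_integers)
    show "algebraic_int x" if "x \<in> K" for x
      using that \<open>I \<subseteq> P\<close> gP ideal_algebraic_int[OF I(1)] by (auto simp: K_def subset_iff)
    show "0 \<in> K" using ideal_0[OF I(1)] by (force simp: K_def)
    show "x + y \<in> K" if "x \<in> K" "y \<in> K" for x y
    proof -
      from that obtain u v u' v' where *: "u \<in> I" "v \<in> I" "u' \<in> I" "v' \<in> I"
        "x = u + g * v" "y = u' + g * v'" by (auto simp: K_def)
      then have "x + y = (u + u') + g * (v + v')" by (simp add: algebra_simps)
      also have "\<dots> \<in> K" using * by (intro KI ideal_add[OF I(1)])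
      finally show ?thesis .
    qed
    show "x * y \<in> K" if "algebraic_int x" "y \<in> K" for x y
    proof -
      from that obtain u v where *: "u \<in> I" "v \<in> I" "y = u + g * v" by (auto simp: K_def)
      then have "x * y = (x * u) + g * (x * v)" by (simp add: algebra_simps)
      also have "\<dots> \<in> K" using * that(1) by (intro KI ideal_mult[OF I(1)])
      finally show ?thesis .
    qed
  qed
  have "ideal_prod R P K = I"
  proof (intro equalityI subsetI)
    fix x assume "x \<in> ideal_prod R P K"
    then show "x \<in> I"
    proof (induction rule: ideal_prod.induct)
      case (prod i j)
      then obtain u v where *: "u \<in> I" "v \<in> I" "j = u + g * v" by (auto simp: K_def)
      have "i * u + g * i * v \<in> I"
        using * prod(1) I(1) gP P_int by (intro ideal_add ideal_mult) auto
      then show ?case using * by (simp add: algebra_simps)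
    qed (use ideal_add[OF I(1)] in simp)
  next
    fix x assume x: "x \<in> I"
    define q where "q = g * p * y - 1"
    have "q \<in> P" using y(2) by (simp add: q_def)
    have mem: "0 + g * (y * x) \<in> K" "- x + g * 0 \<in> K"
      using ideal_mult[OF I(1) y(1) x] ideal_uminus[OF I(1) x] ideal_0[OF I(1)] by (intro KI; simp)+
    \<comment> \<open>Since \<open>g * p * y - q = 1\<close>, \<open>x\<close> equals
      \<open>p * (g * (y * x)) - q * x\<close>. The zero summands give the second factors the form
      \<open>u + g * v\<close> of elements of \<open>K\<close>.\<close>
    have "p * (0 + g * (y * x)) + q * (- x + g * 0) \<in> ideal_prod R P K"
      using ideal_prod.sum[where R = R, OF ideal_prod.prod[OF p(1) mem(1)] ideal_prod.prod[OF \<open>q \<in> P\<close> mem(2)]]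
      by (simp only: ring_of_integers_simps)
    also have "p * (0 + g * (y * x)) + q * (- x + g * 0) = x"
      by (simp add: q_def algebra_simps)
    finally show "x \<in> ideal_prod R P K" .
  qed
  then show ?thesis using K by (auto simp: ideal_dvd_def)
qed

lemma ideal_dvd_imp_subset:
  assumes "ideal P R" and "ideal_dvd P I"
  shows "I \<subseteq> P"
proof -
  obtain K where K: "ideal K R" "I = ideal_prod R P K"
    using assms(2) by (auto simp: ideal_dvd_def)
  have "x \<in> P" if "x \<in> ideal_prod R P K" for x
    using that
    by (induction rule: ideal_prod.induct)
      (use ideal_add[OF assms(1)] ideal_mult'[OF assms(1)] ideal_algebraic_int[OF K(1)] in auto)
  then show ?thesis using K by auto
qed

end

section \<open>Counting matrices modulo an ideal\<close>

locale modulus = number_ring W for W :: "'a :: field_char_0 set" +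
  fixes I :: "'a set"
  assumes I: "ideal I R" and I_nonzero: "I \<noteq> {0}"
begin

abbreviation \<rho> :: "'a \<Rightarrow> 'a" where "\<rho> \<equiv> rep I"
abbreviation X :: "'a set" where "X \<equiv> reps I"

section \<open>Primes containing the modulus\<close>

definition primes_over :: "'a set set" where
  "primes_over = {P. primeideal P R \<and> I \<subseteq> P}"

text \<open>The condition that \<open>a\<close> and \<open>b\<close> generate the unit ideal modulo
  \<open>I\<close>, written so that \<open>(c, d)\<close> is a second row completing
  \<open>(a, b)\<close> to determinant \<open>1\<close>.\<close>

definition unimodular :: "'a \<Rightarrow> 'a \<Rightarrow> bool" where
  "unimodular a b \<longleftrightarrow> (\<exists>c d. algebraic_int c \<and> algebraic_int d \<and> a * d - b * c - 1 \<in> I)"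

lemma finite_X [simp]: "finite X"
  using finite_reps[OF I I_nonzero] .

lemmas X_algebraic_int [intro] = reps_algebraic_int[OF I]

lemma card_X_pos: "card X > 0"
  using rep_in_reps[of 0 I] by (auto simp: card_gt_0_iff)

lemma rep_mem_iff:
  assumes J: "ideal J R" "I \<subseteq> J" and x: "algebraic_int x"
  shows "\<rho> x \<in> J \<longleftrightarrow> x \<in> J"
  using ideal_add[OF J(1), of "\<rho> x - x" x] ideal_diff[OF J(1), of "\<rho> x" "\<rho> x - x"]
    rep_diff[OF I x] J(2) by auto

text \<open>An ideal above \<open>I\<close> is a union of classes modulo \<open>I\<close>, hence
  determined by the representatives it contains. The finiteness also supplies maximal ideals later
  on.\<close>

lemma finite_ideals_over: "finite {J. ideal J R \<and> I \<subseteq> J}"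
proof (rule finite_imageD)
  show "finite ((\<inter>) X ` {J. ideal J R \<and> I \<subseteq> J})"
    by (rule finite_subset[of _ "Pow X"]) auto
  have "J \<subseteq> J'" if "ideal J R" "I \<subseteq> J" "ideal J' R" "I \<subseteq> J'" "X \<inter> J = X \<inter> J'" for J J'
  proof
    fix x assume x: "x \<in> J"
    then have int: "algebraic_int x" using ideal_algebraic_int that by blast
    have "\<rho> x \<in> X \<inter> J" using rep_in_reps[OF int] rep_mem_iff[OF that(1,2) int] x by blast
    then show "x \<in> J'" using rep_mem_iff[OF that(3,4) int] that(5) by blast
  qed
  then show "inj_on ((\<inter>) X) {J. ideal J R \<and> I \<subseteq> J}"
    unfolding inj_on_def by (metis (no_types, lifting) mem_Collect_eq subset_antisym)
qed

lemma primes_over_ideal: "P \<in> primes_over \<Longrightarrow> ideal P R"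
  by (auto simp: primes_over_def primeideal.axioms)

lemma primes_over_nonzero: "P \<in> primes_over \<Longrightarrow> P \<noteq> {0}"
  using I_nonzero ideal_0[OF I] by (auto simp: primes_over_def)

lemma finite_primes_over [simp]: "finite primes_over"
  by (rule finite_subset[OF _ finite_ideals_over]) (auto simp: primes_over_def primeideal.axioms)

text \<open>An element of \<open>P\<close> outside \<open>Q\<close> is invertible modulo
  \<open>Q\<close>; if \<open>Q \<subseteq> P\<close>, this puts \<open>1\<close> into
  \<open>P\<close>.\<close>

lemma primes_over_incomparable:
  assumes P: "P \<in> primes_over" and Q: "Q \<in> primes_over" and "Q \<subseteq> P"
  shows "Q = P"
proof (rule ccontr)
  assume "Q \<noteq> P"
  then obtain x where x: "x \<in> P" "x \<notin> Q" using \<open>Q \<subseteq> P\<close> by blast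
  have P': "ideal P R" "primeideal P R" using P primes_over_ideal by (auto simp: primes_over_def)
  have "algebraic_int x" using ideal_algebraic_int[OF P'(1) x(1)] .
  then obtain y where y: "algebraic_int y" "x * y - 1 \<in> Q"
    using prime_ideal_inverse[of Q x] Q primes_over_nonzero x by (auto simp: primes_over_def)
  then have "1 \<in> P"
    using ideal_diff[OF P'(1) ideal_mult'[OF P'(1) y(1) x(1)], of "x * y - 1"] \<open>Q \<subseteq> P\<close> by auto
  then show False using prime_ideal_one[OF P'(2)] by simp
qed

text \<open>The form of the Chinese remainder theorem used below: multiply elements of each
  \<open>Q\<close> outside \<open>P\<close>, then normalize by an inverse modulo
  \<open>P\<close>.\<close>

lemma primes_over_separate:
  assumes P: "P \<in> primes_over" and "finite S" and "S \<subseteq> primes_over" and "P \<notin> S"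
  obtains e where "algebraic_int e" and "e - 1 \<in> P" and "\<And>Q. Q \<in> S \<Longrightarrow> e \<in> Q"
proof -
  have P': "ideal P R" "primeideal P R" "P \<noteq> {0}"
    using P primes_over_ideal primes_over_nonzero by (auto simp: primes_over_def)
  have "\<exists>x. x \<in> Q \<and> x \<notin> P" if "Q \<in> S" for Q
    using primes_over_incomparable[OF P, of Q] that assms by blast
  then obtain f where f: "\<And>Q. Q \<in> S \<Longrightarrow> f Q \<in> Q" "\<And>Q. Q \<in> S \<Longrightarrow> f Q \<notin> P"
    by metis
  have S_ideal: "ideal Q R" if "Q \<in> S" for Q using that assms(3) primes_over_ideal by blast
  then have f_int: "algebraic_int (f Q)" if "Q \<in> S" for Q
    using that f ideal_algebraic_int by blast
  have prod: "algebraic_int (prod f S)" "prod f S \<notin> P"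
    using f_int f prime_ideal_prod[OF P'(2) \<open>finite S\<close>] by (auto intro: algebraic_int_prod)
  then obtain y where y: "algebraic_int y" "prod f S * y - 1 \<in> P"
    using prime_ideal_inverse[OF P'(2,3)] by blast
  show thesis
  proof (rule that[of "prod f S * y"])
    fix Q assume Q: "Q \<in> S"
    have "algebraic_int (prod f (S - {Q}) * y)"
      using f_int y by (intro algebraic_int_mult algebraic_int_prod) auto
    then have "f Q * (prod f (S - {Q}) * y) \<in> Q"
      using ideal_mult'[OF S_ideal[OF Q]] f(1)[OF Q] by blast
    then show "prod f S * y \<in> Q"
      using prod.remove[OF \<open>finite S\<close> Q, of f] by (simp add: mult.assoc)
  qed (use prod y in auto)
qed

section \<open>Counting unimodular rows\<close>

text \<open>A class modulo \<open>I\<close> is uniquely a class modulo \<open>J\<close> plus a class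
  of \<open>J\<close> modulo \<open>I\<close>.\<close>

lemma card_reps_over:
  assumes J: "ideal J R" "I \<subseteq> J"
  shows "card X = ideal_norm J * card (X \<inter> J)"
proof -
  let ?f = "\<lambda>(p, q). \<rho> (p + q)"
  have int: "algebraic_int p" if "p \<in> reps J" for p using reps_algebraic_int[OF J(1) that] .
  have "bij_betw ?f (reps J \<times> (X \<inter> J)) X"
  proof (rule bij_betw_imageI)
    show "inj_on ?f (reps J \<times> (X \<inter> J))"
    proof (rule inj_onI, clarify)
      fix p q p' q' assume *: "p \<in> reps J" "p' \<in> reps J" "q \<in> X" "q \<in> J" "q' \<in> X" "q' \<in> J"
        and "\<rho> (p + q) = \<rho> (p' + q')"
      then have d: "p + q - (p' + q') \<in> I"
        using int X_algebraic_int by (subst (asm) rep_eq_iff[OF I]) auto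
      then have "p + q - (p' + q') + (q' - q) \<in> J"
        using * J ideal_add[OF J(1) _ ideal_diff[OF J(1)]] by blast
      then have p: "p = p'" using * by (intro reps_eqI[OF J(1)]) (auto simp: algebra_simps)
      moreover have "q = q'" using * d p by (intro reps_eqI[OF I]) auto
      ultimately show "p = p' \<and> q = q'" by simp
    qed
    show "?f ` (reps J \<times> (X \<inter> J)) = X"
    proof (intro equalityI subsetI)
      fix x assume x: "x \<in> X"
      then have x_int: "algebraic_int x" by blast
      let ?p = "rep J x"
      have p_int: "algebraic_int ?p" using J x_int by auto
      let ?q = "\<rho> (x - ?p)"
      have "x - ?p \<in> J" using ideal_uminus[OF J(1) rep_diff[OF J(1) x_int]] by simp
      then have q: "?q \<in> X \<inter> J" using rep_mem_iff[OF J] rep_in_reps[of "x - ?p" I] x_int p_int by auto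
      have "?p + ?q - x \<in> I" using rep_diff[OF I, of "x - ?p"] x_int p_int by (simp add: algebra_simps)
      then have "\<rho> (?p + ?q) = \<rho> x" using q p_int x_int by (subst rep_eq_iff[OF I]) auto
      then have "x = ?f (?p, ?q)" using rep_reps[OF I x] by simp
      then show "x \<in> ?f ` (reps J \<times> (X \<inter> J))" using q rep_in_reps[OF x_int] by blast
    qed (use int X_algebraic_int in \<open>auto intro!: rep_in_reps\<close>)
  qed
  then show ?thesis
    using bij_betw_same_card by (fastforce simp: card_cartesian_product ideal_norm_eq[OF J(1)])
qed

text \<open>Translations by multiples of an \<open>e\<close> that is \<open>1\<close> modulo \<open>P\<close> and \<open>0\<close> modulo the primes in \<open>S\<close>
  preserve \<open>A\<close> and permute the classes modulo \<open>P\<close> transitively, so \<open>A\<close> is equidistributed among them.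
  Counting with multiplicities makes this an explicit bijection.\<close>

lemma card_pairs_prime_step:
  assumes P: "P \<in> primes_over" and S: "finite S" "S \<subseteq> primes_over" "P \<notin> S"
  defines "A \<equiv> {(a, b) \<in> X \<times> X. \<forall>Q\<in>S. \<not> (a \<in> Q \<and> b \<in> Q)}"
  shows "card (A \<inter> P \<times> P) * (card X)\<^sup>2 = card A * (card (X \<inter> P))\<^sup>2"
proof -
  obtain e where e: "algebraic_int e" "e - 1 \<in> P" "\<And>Q. Q \<in> S \<Longrightarrow> e \<in> Q"
    using primes_over_separate[OF P S] by blast
  \<comment> \<open>\<open>\<phi>\<close> is the translation by \<open>e * u\<close>.
    \<open>\<psi>\<close> is chosen so that \<open>\<phi> + \<psi>\<close> is \<open>u\<close>
    modulo \<open>I\<close>, which lets \<open>u\<close> be recovered, while \<open>\<psi>\<close>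
    is \<open>- a\<close> modulo \<open>P\<close> because \<open>e\<close> is \<open>1\<close>
    there.\<close>
  define \<phi> where "\<phi> = (\<lambda>(a, u). \<rho> (a + e * u))"
  define \<psi> where "\<psi> = (\<lambda>(a, u). \<rho> (u - a - e * u))"
  define F where "F = (\<lambda>((a, b), (u, v)). ((\<phi> (a, u), \<phi> (b, v)), (\<psi> (a, u), \<psi> (b, v))))"
  let ?D = "(X \<times> X) \<times> (X \<times> X)"
  have P': "ideal P R" "I \<subseteq> P" using P primes_over_ideal by (auto simp: primes_over_def)
  have Q': "ideal Q R" "I \<subseteq> Q" if "Q \<in> S" for Q
    using that S(2) primes_over_ideal by (auto simp: primes_over_def)
  have in_X: "\<phi> (a, u) \<in> X" "\<psi> (a, u) \<in> X" if "a \<in> X" "u \<in> X" for a u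
    using that e(1) X_algebraic_int by (auto simp: \<phi>_def \<psi>_def intro!: rep_in_reps)
  have \<phi>_mem: "\<phi> (a, u) \<in> Q \<longleftrightarrow> a \<in> Q" if "a \<in> X" "u \<in> X" "Q \<in> S" for a u Q
  proof -
    have eu: "e * u \<in> Q" using that e Q' X_algebraic_int by (auto intro!: ideal_mult')
    have "\<phi> (a, u) \<in> Q \<longleftrightarrow> a + e * u \<in> Q"
      unfolding \<phi>_def using that e(1) X_algebraic_int Q'[OF that(3)] by (auto simp: rep_mem_iff)
    also have "\<dots> \<longleftrightarrow> a \<in> Q"
      using ideal_add[OF Q'(1) _ eu, of a] ideal_diff[OF Q'(1) _ eu, of "a + e * u"] that by auto
    finally show ?thesis .
  qed
  have \<psi>_mem: "\<psi> (a, u) \<in> P \<longleftrightarrow> a \<in> P" if "a \<in> X" "u \<in> X" for a u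
  proof -
    have eu: "(e - 1) * u \<in> P" using that e P' X_algebraic_int by (auto intro!: ideal_mult')
    have "\<psi> (a, u) \<in> P \<longleftrightarrow> u - a - e * u \<in> P"
      unfolding \<psi>_def using that e(1) X_algebraic_int P' by (auto simp: rep_mem_iff)
    also have "u - a - e * u = - (a + (e - 1) * u)" by (simp add: algebra_simps)
    also have "\<dots> \<in> P \<longleftrightarrow> a + (e - 1) * u \<in> P"
      by (rule ideal_uminus_iff[OF P'(1)])
    also have "\<dots> \<longleftrightarrow> a \<in> P"
      using ideal_add[OF P'(1) _ eu, of a] ideal_diff[OF P'(1) _ eu, of "a + (e - 1) * u"] by auto
    finally show ?thesis .
  qed
  have inj1: "a = a' \<and> u = u'"
    if *: "a \<in> X" "u \<in> X" "a' \<in> X" "u' \<in> X" and eq: "\<phi> (a, u) = \<phi> (a', u')" "\<psi> (a, u) = \<psi> (a', u')"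
    for a u a' u'
  proof -
    have int: "algebraic_int a" "algebraic_int u" "algebraic_int a'" "algebraic_int u'"
      using * by blast+
    have d: "a + e * u - (a' + e * u') \<in> I" "u - a - e * u - (u' - a' - e * u') \<in> I"
      using eq int e(1) by (auto simp: \<phi>_def \<psi>_def rep_eq_iff[OF I])
    have "u - u' \<in> I" using ideal_add[OF I d] by simp
    then have "u = u'" using * reps_eqI[OF I] by blast
    then show ?thesis using d(1) * reps_eqI[OF I, of a a'] by simp
  qed
  have inj: "inj_on F ?D"
  proof (rule inj_onI)
    fix z z' assume z: "z \<in> ?D" "z' \<in> ?D" and eq: "F z = F z'"
    obtain a b u v where z_def: "z = ((a, b), (u, v))" by (metis prod.exhaust)
    obtain a' b' u' v' where z'_def: "z' = ((a', b'), (u', v'))" by (metis prod.exhaust)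
    have "\<phi> (a, u) = \<phi> (a', u')" "\<psi> (a, u) = \<psi> (a', u')"
      "\<phi> (b, v) = \<phi> (b', v')" "\<psi> (b, v) = \<psi> (b', v')"
      using eq by (simp_all add: F_def z_def z'_def)
    then show "z = z'"
      using inj1[of a u a' u'] inj1[of b v b' v'] z by (simp add: z_def z'_def)
  qed
  have surj: "F ` ?D = ?D"
    by (rule endo_inj_surj[OF _ _ inj]) (auto simp: F_def in_X)
  \<comment> \<open>The conditions at primes in \<open>S\<close> are carried by the
    \<open>\<phi>\<close> components, and the condition at \<open>P\<close> moves from
    \<open>(a, b)\<close> to the \<open>\<psi>\<close> components.\<close>
  have F_mem: "F z \<in> A \<times> ((X \<inter> P) \<times> (X \<inter> P)) \<longleftrightarrow> z \<in> (A \<inter> P \<times> P) \<times> (X \<times> X)" if "z \<in> ?D" for z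
  proof -
    obtain a b u v where z: "z = ((a, b), (u, v))" by (metis prod.exhaust)
    have X: "a \<in> X" "b \<in> X" "u \<in> X" "v \<in> X" using that by (simp_all add: z)
    have "(\<forall>Q\<in>S. \<not> (\<phi> (a, u) \<in> Q \<and> \<phi> (b, v) \<in> Q)) \<longleftrightarrow> (\<forall>Q\<in>S. \<not> (a \<in> Q \<and> b \<in> Q))"
      using \<phi>_mem X by blast
    moreover have "\<psi> (a, u) \<in> P \<longleftrightarrow> a \<in> P" "\<psi> (b, v) \<in> P \<longleftrightarrow> b \<in> P"
      using \<psi>_mem X by blast+
    moreover have "\<phi> (a, u) \<in> X" "\<phi> (b, v) \<in> X" "\<psi> (a, u) \<in> X" "\<psi> (b, v) \<in> X"
      using in_X X by blast+
    ultimately show ?thesis using X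
      by (simp only: z F_def A_def prod.case mem_Times_iff Int_iff mem_Collect_eq fst_conv snd_conv) blast
  qed
  have sub: "(A \<inter> P \<times> P) \<times> (X \<times> X) \<subseteq> ?D" "A \<times> ((X \<inter> P) \<times> (X \<inter> P)) \<subseteq> ?D"
    by (auto simp: A_def)
  have "F ` ((A \<inter> P \<times> P) \<times> (X \<times> X)) = A \<times> ((X \<inter> P) \<times> (X \<inter> P))"
  proof (intro equalityI subsetI)
    fix y assume y: "y \<in> A \<times> ((X \<inter> P) \<times> (X \<inter> P))"
    then have "y \<in> F ` ?D" using sub(2) surj by blast
    then obtain z where z: "z \<in> ?D" "y = F z" by blast
    show "y \<in> F ` ((A \<inter> P \<times> P) \<times> (X \<times> X))"
      unfolding z(2) using y[unfolded z(2) F_mem[OF z(1)]] by (rule imageI)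
  next
    fix y assume "y \<in> F ` ((A \<inter> P \<times> P) \<times> (X \<times> X))"
    then obtain z where z: "z \<in> (A \<inter> P \<times> P) \<times> (X \<times> X)" "y = F z" by blast
    show "y \<in> A \<times> ((X \<inter> P) \<times> (X \<inter> P))"
      unfolding z(2) F_mem[OF subsetD[OF sub(1) z(1)]] using z(1) .
  qed
  then have "bij_betw F ((A \<inter> P \<times> P) \<times> (X \<times> X)) (A \<times> ((X \<inter> P) \<times> (X \<inter> P)))"
    using inj_on_subset[OF inj sub(1)] by (simp add: bij_betw_def)
  from bij_betw_same_card[OF this] show ?thesis
    by (simp add: card_cartesian_product power2_eq_square)
qed

text \<open>Induction on \<open>S\<close>: among the pairs left by the previous primes, the fraction
  \<open>1 / N(P)^2\<close> lies in \<open>P \<times> P\<close> and is removed.\<close>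

lemma card_pairs:
  assumes "S \<subseteq> primes_over"
  shows "real (card {(a, b) \<in> X \<times> X. \<forall>P\<in>S. \<not> (a \<in> P \<and> b \<in> P)}) =
    real (card X) ^ 2 * (\<Prod>P\<in>S. 1 - 1 / real (ideal_norm P) ^ 2)"
proof -
  have "finite S" using assms finite_primes_over finite_subset by blast
  then show ?thesis using assms
  proof (induction S)
    case empty
    have "{(a, b). a \<in> X \<and> b \<in> X} = X \<times> X" by auto
    then show ?case by (simp add: card_cartesian_product power2_eq_square)
  next
    case (insert P S)
    let ?A = "{(a, b) \<in> X \<times> X. \<forall>Q\<in>S. \<not> (a \<in> Q \<and> b \<in> Q)}"
    let ?N = "real (ideal_norm P)"
    have P: "P \<in> primes_over" using insert by auto
    have fin: "finite ?A" by (rule finite_subset[of _ "X \<times> X"]) auto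
    define k where "k = card (X \<inter> P)"
    have X: "card X = ideal_norm P * k"
      unfolding k_def using card_reps_over[of P] P primes_over_ideal by (auto simp: primes_over_def)
    then have pos: "ideal_norm P > 0" "k > 0" using card_X_pos by (auto intro: gr0I)
    have "real (card (?A \<inter> P \<times> P)) * (real (card X))\<^sup>2 = real (card ?A) * (real k)\<^sup>2"
      unfolding k_def using card_pairs_prime_step[OF P insert(1) _ insert(2)] insert.prems
      by (simp flip: of_nat_mult of_nat_power)
    then have B: "real (card (?A \<inter> P \<times> P)) = real (card ?A) / ?N ^ 2"
      using pos by (simp add: X power_mult_distrib field_simps)
    have "{(a, b) \<in> X \<times> X. \<forall>Q\<in>insert P S. \<not> (a \<in> Q \<and> b \<in> Q)} = ?A - ?A \<inter> P \<times> P" by auto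
    then have "real (card {(a, b) \<in> X \<times> X. \<forall>Q\<in>insert P S. \<not> (a \<in> Q \<and> b \<in> Q)}) =
        real (card ?A) - real (card (?A \<inter> P \<times> P))"
      using fin by (simp add: card_Diff_subset of_nat_diff card_mono)
    also have "\<dots> = real (card ?A) * (1 - 1 / ?N ^ 2)"
      unfolding B by (simp add: algebra_simps)
    finally show ?case using insert by (simp add: mult_ac)
  qed
qed

text \<open>If the ideal generated by \<open>a\<close>, \<open>b\<close> and \<open>I\<close> were
  proper, a maximal ideal above it would be a prime containing \<open>I\<close> and both
  entries.\<close>

lemma unimodular_iff:
  assumes a: "algebraic_int a" and b: "algebraic_int b"
  shows "unimodular a b \<longleftrightarrow> (\<forall>P\<in>primes_over. \<not> (a \<in> P \<and> b \<in> P))"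
proof
  assume "unimodular a b"
  then obtain c d where cd: "algebraic_int c" "algebraic_int d" "a * d - b * c - 1 \<in> I"
    by (auto simp: unimodular_def)
  show "\<forall>P\<in>primes_over. \<not> (a \<in> P \<and> b \<in> P)"
  proof (intro ballI notI)
    fix P assume P: "P \<in> primes_over" and ab: "a \<in> P \<and> b \<in> P"
    note P' = primes_over_ideal[OF P]
    have "a * d \<in> P" "b * c \<in> P" using ab cd P' by (auto intro: ideal_mult')
    moreover have "a * d - b * c - 1 \<in> P" using P cd by (auto simp: primes_over_def)
    ultimately have "a * d - b * c - (a * d - b * c - 1) \<in> P"
      using ideal_diff[OF P'] by blast
    then show False using prime_ideal_one P by (auto simp: primes_over_def)
  qed
next
  assume no_prime: "\<forall>P\<in>primes_over. \<not> (a \<in> P \<and> b \<in> P)"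
  define J where "J = {a * x - b * y + z |x y z. algebraic_int x \<and> algebraic_int y \<and> z \<in> I}"
  have JI: "a * x - b * y + z \<in> J" if "algebraic_int x" "algebraic_int y" "z \<in> I" for x y z
    using that by (auto simp: J_def)
  have J: "ideal J R"
  proof (rule idealI_integers)
    show "algebraic_int x" if "x \<in> J" for x
      using that a b ideal_algebraic_int[OF I] by (auto simp: J_def)
    show "0 \<in> J" using JI[of 0 0 0] ideal_0[OF I] by simp
    show "u + v \<in> J" if uv: "u \<in> J" "v \<in> J" for u v
    proof -
      from uv obtain x y z x' y' z' where *:
        "algebraic_int x" "algebraic_int y" "z \<in> I" "u = a * x - b * y + z"
        "algebraic_int x'" "algebraic_int y'" "z' \<in> I" "v = a * x' - b * y' + z'"
        unfolding J_def by blast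
      have "u + v = a * (x + x') - b * (y + y') + (z + z')"
        unfolding *(4,8) by (simp add: algebra_simps)
      also have "\<dots> \<in> J" using * ideal_add[OF I] by (intro JI) auto
      finally show ?thesis .
    qed
    show "u * v \<in> J" if uv: "algebraic_int u" "v \<in> J" for u v
    proof -
      from uv obtain x y z where *: "algebraic_int x" "algebraic_int y" "z \<in> I" "v = a * x - b * y + z"
        unfolding J_def by blast
      have "u * v = a * (u * x) - b * (u * y) + u * z"
        unfolding *(4) by (simp add: algebra_simps)
      also have "\<dots> \<in> J" using * uv ideal_mult[OF I] by (intro JI) auto
      finally show ?thesis .
    qed
  qed
  have J_mem: "I \<subseteq> J" "a \<in> J" "b \<in> J"
    using JI[of 0 0] JI[of 1 0 0] JI[of 0 "-1" 0] ideal_0[OF I] by auto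
  have "1 \<in> J"
  proof (rule ccontr)
    assume "1 \<notin> J"
    \<comment> \<open>A maximal element of this finite nonempty set is a maximal ideal of the ring,
      since any ideal above it that omits \<open>1\<close> is again in the set.\<close>
    let ?\<J> = "{M. ideal M R \<and> J \<subseteq> M \<and> 1 \<notin> M}"
    have "finite ?\<J>"
      by (rule finite_subset[OF _ finite_ideals_over]) (use J_mem in auto)
    moreover have "J \<in> ?\<J>" using J \<open>1 \<notin> J\<close> by auto
    ultimately obtain M where M: "M \<in> ?\<J>" "\<forall>M'\<in>?\<J>. M \<subseteq> M' \<longrightarrow> M = M'"
      using finite_has_maximal[of ?\<J>] by blast
    have "maximalideal M R"
    proof (rule maximalidealI)
      show "carrier R \<noteq> M" using M by auto
      show "M' = M \<or> M' = carrier R" if M': "ideal M' R" "M \<subseteq> M'" for M'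
        using M M' ideal_eq_carrier_iff[OF M'(1)] by blast
    qed (use M in auto)
    then have "primeideal M R" using cring.maximalideal_prime[OF ring_of_integers_cring] by blast
    then have "M \<in> primes_over" using M J_mem by (auto simp: primes_over_def)
    then show False using no_prime M J_mem by blast
  qed
  then obtain x y z where *: "algebraic_int x" "algebraic_int y" "z \<in> I" "1 = a * x - b * y + z"
    unfolding J_def by blast
  then have "a * x - b * y - 1 = - z" by (simp only: *(4)) simp
  then have "a * x - b * y - 1 \<in> I" using ideal_uminus[OF I] * by simp
  then show "unimodular a b" using * by (auto simp: unimodular_def)
qed

section \<open>Counting matrices of determinant one over the residue ring\<close>

text \<open>This is SL(2) of the residue ring modulo \<open>I\<close>, with matrices written row by
  row as quadruples of representatives.\<close>

definition SL2_residues :: "('a \<times> 'a \<times> 'a \<times> 'a) set" where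
  "SL2_residues = {(a, b, c, d). a \<in> X \<and> b \<in> X \<and> c \<in> X \<and> d \<in> X \<and> a * d - b * c - 1 \<in> I}"

text \<open>Fix one completion \<open>(f a b, g a b)\<close> of each unimodular row. All other
  completions arise by adding a multiple \<open>t\<close> of the first row, and \<open>t\<close> is
  unique modulo \<open>I\<close>.\<close>

lemma card_SL2_residues_unimodular:
  "card SL2_residues = card {(a, b) \<in> X \<times> X. unimodular a b} * card X"
proof -
  let ?U = "{(a, b) \<in> X \<times> X. unimodular a b}"
  obtain f g where fg: "\<And>a b. unimodular a b \<Longrightarrow> algebraic_int (f a b)"
    "\<And>a b. unimodular a b \<Longrightarrow> algebraic_int (g a b)"
    "\<And>a b. unimodular a b \<Longrightarrow> a * g a b - b * f a b - 1 \<in> I"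
  proof -
    have "\<forall>a b. \<exists>c d. unimodular a b \<longrightarrow>
        algebraic_int c \<and> algebraic_int d \<and> a * d - b * c - 1 \<in> I"
      unfolding unimodular_def by blast
    then show thesis using that by metis
  qed
  define F where "F = (\<lambda>((a, b), t). (a, b, \<rho> (f a b + t * a), \<rho> (g a b + t * b)))"
  have "bij_betw F (?U \<times> X) SL2_residues"
  proof (rule bij_betw_imageI)
    show "inj_on F (?U \<times> X)"
    proof (rule inj_onI)
      fix z z' assume z: "z \<in> ?U \<times> X" "z' \<in> ?U \<times> X" and F_eq: "F z = F z'"
      obtain a b t where z_def: "z = ((a, b), t)" by (metis prod.exhaust)
      obtain a' b' t' where z'_def: "z' = ((a', b'), t')" by (metis prod.exhaust)
      have X: "a \<in> X" "b \<in> X" "t \<in> X" "t' \<in> X" and uni: "unimodular a b"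
        using z by (simp_all add: z_def z'_def)
      have eq: "F ((a, b), t) = F ((a', b'), t')" using F_eq by (simp add: z_def z'_def)
      have ab: "a' = a" "b' = b" using eq by (auto simp: F_def)
      have int: "algebraic_int a" "algebraic_int b" "algebraic_int t" "algebraic_int t'"
        using X by blast+
      have d: "(t - t') * a \<in> I" "(t - t') * b \<in> I"
        using eq ab int fg[OF uni] by (auto simp: F_def rep_eq_iff[OF I] algebra_simps)
      \<comment> \<open>As \<open>a * g a b - b * f a b\<close> is \<open>1\<close> modulo
        \<open>I\<close>, the multiples of \<open>t - t'\<close> by \<open>a\<close> and
        \<open>b\<close> determine \<open>t - t'\<close> modulo \<open>I\<close>.\<close>
      have "t - t' = g a b * ((t - t') * a) + (- f a b) * ((t - t') * b)
          + (t' - t) * (a * g a b - b * f a b - 1)"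
        by (simp add: algebra_simps)
      also have "\<dots> \<in> I"
        by (rule ideal_lincomb[OF I]) (use d int fg[OF uni] in simp_all)
      finally have "t = t'" using X reps_eqI[OF I] by blast
      then show "z = z'" using ab by (simp add: z_def z'_def)
    qed
    show "F ` (?U \<times> X) = SL2_residues"
    proof (intro equalityI subsetI)
      fix z assume "z \<in> F ` (?U \<times> X)"
      then obtain a b t where z: "z = F ((a, b), t)" and X: "a \<in> X" "b \<in> X" "t \<in> X"
        and uni: "unimodular a b" by blast
      have int: "algebraic_int a" "algebraic_int b" "algebraic_int t" using X by blast+
      let ?c = "f a b + t * a" and ?d = "g a b + t * b"
      have cd: "algebraic_int ?c" "algebraic_int ?d" using int fg[OF uni] by auto
      have "a * \<rho> ?d - b * \<rho> ?c - 1 =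
          a * (\<rho> ?d - ?d) + (- b) * (\<rho> ?c - ?c) + 1 * (a * g a b - b * f a b - 1)"
        by (simp add: algebra_simps)
      also have "\<dots> \<in> I"
        by (rule ideal_lincomb[OF I]) (use fg[OF uni] int cd rep_diff[OF I] in simp_all)
      finally show "z \<in> SL2_residues"
        using X cd by (auto simp: z F_def SL2_residues_def intro: rep_in_reps)
    next
      fix z assume "z \<in> SL2_residues"
      then obtain a b c d where z: "z = (a, b, c, d)" and X: "a \<in> X" "b \<in> X" "c \<in> X" "d \<in> X"
        and det: "a * d - b * c - 1 \<in> I" by (auto simp: SL2_residues_def)
      have int: "algebraic_int a" "algebraic_int b" "algebraic_int c" "algebraic_int d"
        using X by blast+
      have uni: "unimodular a b" using int det by (auto simp: unimodular_def)
      let ?f = "f a b" and ?g = "g a b"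
      \<comment> \<open>Cramer's rule for the multiple of \<open>(a, b)\<close> by which
        \<open>(c, d)\<close> differs from \<open>(?f, ?g)\<close>: both rows complete
        \<open>(a, b)\<close> to determinant \<open>1\<close> modulo \<open>I\<close>.\<close>
      define s where "s = c * ?g - d * ?f"
      have s: "algebraic_int s" using int fg[OF uni] by (auto simp: s_def)
      have \<rho>s: "\<rho> s - s \<in> I" "algebraic_int (\<rho> s)" using rep_diff[OF I s] s I by auto
      have "?f + \<rho> s * a - c =
          c * (a * ?g - b * ?f - 1) + (- ?f) * (a * d - b * c - 1) + a * (\<rho> s - s)"
        by (simp add: algebra_simps s_def)
      also have "\<dots> \<in> I"
        by (rule ideal_lincomb[OF I]) (use fg[OF uni] int \<rho>s det in simp_all)
      finally have c: "\<rho> (?f + \<rho> s * a) = \<rho> c" using int fg[OF uni] \<rho>s by (simp add: rep_eq_iff[OF I])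
      have "?g + \<rho> s * b - d =
          d * (a * ?g - b * ?f - 1) + (- ?g) * (a * d - b * c - 1) + b * (\<rho> s - s)"
        by (simp add: algebra_simps s_def)
      also have "\<dots> \<in> I"
        by (rule ideal_lincomb[OF I]) (use fg[OF uni] int \<rho>s det in simp_all)
      finally have d: "\<rho> (?g + \<rho> s * b) = \<rho> d" using int fg[OF uni] \<rho>s by (simp add: rep_eq_iff[OF I])
      then have "z = F ((a, b), \<rho> s)"
        using X c by (simp add: z F_def rep_reps[OF I])
      then show "z \<in> F ` (?U \<times> X)" using X uni rep_in_reps[OF s] by blast
    qed
  qed
  then show ?thesis using bij_betw_same_card by (fastforce simp: card_cartesian_product)
qed

lemma card_SL2_residues:
  "real (card SL2_residues) =
    real (ideal_norm I) ^ 3 * (\<Prod>P\<in>primes_over. 1 - 1 / real (ideal_norm P) ^ 2)"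
proof -
  have "{(a, b) \<in> X \<times> X. unimodular a b} =
      {(a, b) \<in> X \<times> X. \<forall>P\<in>primes_over. \<not> (a \<in> P \<and> b \<in> P)}"
    using unimodular_iff by auto
  then show ?thesis
    using card_pairs[of primes_over]
    by (simp add: card_SL2_residues_unimodular ideal_norm_eq[OF I] power3_eq_cube power2_eq_square)
qed

end

section \<open>Indices of congruence subgroups\<close>

definition mat2 :: "'a \<Rightarrow> 'a \<Rightarrow> 'a \<Rightarrow> 'a \<Rightarrow> 'a :: field_char_0 ^ 2 ^ 2" where
  "mat2 a b c d = vector [vector [a, b], vector [c, d]]"

lemma mat2_nth [simp]:
  "mat2 a b c d $ 1 $ 1 = a" "mat2 a b c d $ 1 $ 2 = b"
  "mat2 a b c d $ 2 $ 1 = c" "mat2 a b c d $ 2 $ 2 = d"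
  by (simp_all add: mat2_def)

lemma mat2_eqI:
  fixes A B :: "'a ^ 2 ^ 2"
  assumes "A $ 1 $ 1 = B $ 1 $ 1" "A $ 1 $ 2 = B $ 1 $ 2" "A $ 2 $ 1 = B $ 2 $ 1" "A $ 2 $ 2 = B $ 2 $ 2"
  shows "A = B"
  using assms by (simp add: vec_eq_iff forall_2)

lemma matrix_mult_2_nth: "((A :: 'a :: field_char_0 ^ 2 ^ 2) ** B) $ i $ j = A $ i $ 1 * B $ 1 $ j + A $ i $ 2 * B $ 2 $ j"
  by (simp add: matrix_matrix_mult_def sum_2)

lemma mat2_mult:
  "mat2 a b c d ** mat2 a' b' c' d' = mat2 (a * a' + b * c') (a * b' + b * d') (c * a' + d * c') (c * b' + d * d')"
  by (rule mat2_eqI) (simp_all add: matrix_mult_2_nth)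

lemma mat_1_mat2: "mat 1 = mat2 1 0 0 1"
  by (rule mat2_eqI) (simp_all add: mat_def)

lemma T_mat_mat2: "T_mat w = mat2 1 w 0 1" and S_mat_mat2: "S_mat = mat2 0 1 (- 1) 0"
  by (simp_all add: T_mat_def S_mat_def mat2_def)

definition adjugate2 :: "'a :: field_char_0 ^ 2 ^ 2 \<Rightarrow> 'a ^ 2 ^ 2" where
  "adjugate2 A = mat2 (A $ 2 $ 2) (- A $ 1 $ 2) (- A $ 2 $ 1) (A $ 1 $ 1)"

lemma adjugate2_mult: "det A = 1 \<Longrightarrow> adjugate2 A ** A = mat 1"
  by (rule mat2_eqI) (auto simp: matrix_mult_2_nth adjugate2_def mat_def det_2 algebra_simps)

lemma SL2_integers_simps [simp]:
  "mult SL2_integers = (**)" "one SL2_integers = mat 1"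
  by (simp_all add: SL2_integers_def)

lemma SL2_integers_carrier:
  "A \<in> carrier SL2_integers \<longleftrightarrow>
    algebraic_int (A $ 1 $ 1) \<and> algebraic_int (A $ 1 $ 2) \<and> algebraic_int (A $ 2 $ 1) \<and>
    algebraic_int (A $ 2 $ 2) \<and> det A = 1"
  by (auto simp: SL2_integers_def forall_2)

context number_ring
begin

section \<open>The special linear group and its elementary subgroup\<close>

abbreviation \<Gamma> :: "('a ^ 2 ^ 2) monoid" where "\<Gamma> \<equiv> SL2_integers"
abbreviation E :: "('a ^ 2 ^ 2) set" where "E \<equiv> generate \<Gamma> (insert S_mat (T_mat ` W))"

lemma adjugate2_in_SL2: "A \<in> carrier \<Gamma> \<Longrightarrow> adjugate2 A \<in> carrier \<Gamma>"
  by (simp add: SL2_integers_carrier adjugate2_def det_2 mult.commute)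

lemma group_SL2_integers: "group \<Gamma>"
proof (rule groupI)
  show "\<exists>B\<in>carrier \<Gamma>. B \<otimes>\<^bsub>\<Gamma>\<^esub> A = \<one>\<^bsub>\<Gamma>\<^esub>" if "A \<in> carrier \<Gamma>" for A
    using adjugate2_in_SL2[OF that] adjugate2_mult[of A] that by (auto simp: SL2_integers_carrier)
next
  show "A \<otimes>\<^bsub>\<Gamma>\<^esub> B \<in> carrier \<Gamma>" if "A \<in> carrier \<Gamma>" "B \<in> carrier \<Gamma>" for A B
    using that by (simp add: SL2_integers_carrier matrix_mult_2_nth det_mul)
qed (simp_all add: SL2_integers_carrier mat_1_mat2[symmetric] matrix_mul_assoc, simp add: mat_def)

lemma inv_SL2: "A \<in> carrier \<Gamma> \<Longrightarrow> inv\<^bsub>\<Gamma>\<^esub> A = adjugate2 A"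
  using adjugate2_mult[of A] adjugate2_in_SL2[of A]
  by (intro group.inv_equality[OF group_SL2_integers]) (auto simp: SL2_integers_carrier)

lemma subgroup_adjugate2: "subgroup H \<Gamma> \<Longrightarrow> A \<in> H \<Longrightarrow> adjugate2 A \<in> H"
  using inv_SL2[of A] subgroup.m_inv_closed[of H \<Gamma> A] subgroup.mem_carrier[of H \<Gamma> A] by simp

lemma subgroup_mult: "subgroup H \<Gamma> \<Longrightarrow> A \<in> H \<Longrightarrow> B \<in> H \<Longrightarrow> A ** B \<in> H"
  using subgroup.m_closed[of H \<Gamma> A B] by simp

lemma subgroup_E: "subgroup E \<Gamma>"
proof (rule group.generate_is_subgroup[OF group_SL2_integers])
  have "algebraic_int w" if "w \<in> W" for w
    using that basis int_mod.span_base by (fastforce simp: integral_basis_def)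
  then show "insert S_mat (T_mat ` W) \<subseteq> carrier \<Gamma>"
    by (auto simp: SL2_integers_carrier T_mat_mat2 S_mat_mat2 det_2)
qed

text \<open>\<open>T_mat\<close> turns addition into multiplication, so the \<open>x\<close> with
  \<open>T_mat x \<in> E\<close> form an integer submodule. It contains the integral basis, hence
  all algebraic integers.\<close>

lemma T_mat_in_E:
  assumes "algebraic_int x"
  shows "T_mat x \<in> E"
proof -
  have add: "T_mat (x + y) \<in> E" if "T_mat x \<in> E" "T_mat y \<in> E" for x y
    using subgroup_mult[OF subgroup_E that(2,1)] by (simp add: T_mat_mat2 mat2_mult)
  have uminus: "T_mat (- x) \<in> E" if "T_mat x \<in> E" for x
    using subgroup_adjugate2[OF subgroup_E that] by (simp add: T_mat_mat2 adjugate2_def)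
  have zero: "T_mat 0 \<in> E"
    using generate.one[of \<Gamma>] by (simp add: T_mat_mat2 mat_1_mat2)
  have nat: "T_mat (of_nat n * x) \<in> E" if "T_mat x \<in> E" for n x
    by (induction n) (use that add zero in \<open>simp_all add: distrib_right\<close>)
  have "int_mod.subspace {x. T_mat x \<in> E}"
  proof (rule int_mod.subspaceI)
    show "of_int k * x \<in> {x. T_mat x \<in> E}" if "x \<in> {x. T_mat x \<in> E}" for k x
    proof (cases k)
      case (nonneg n)
      then show ?thesis using nat that by simp
    next
      case (neg n)
      then have "of_int k * x = - (of_nat (Suc n) * x)"
        by (simp only: of_int_minus of_int_of_nat_eq mult_minus_left)
      then show ?thesis using uminus[OF nat[of x "Suc n"]] that by simp
    qed
  qed (use add zero in auto)
  then have "int_mod.span W \<subseteq> {x. T_mat x \<in> E}"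
    by (intro int_mod.span_minimal) (auto intro: generate.incl)
  moreover have "x \<in> int_mod.span W" using assms basis by (simp add: integral_basis_def)
  ultimately show ?thesis by blast
qed

lemma S_inverse_in_E: "mat2 0 (- 1) 1 0 \<in> E"
  using subgroup_adjugate2[OF subgroup_E generate.incl[of S_mat]]
  by (simp add: S_mat_mat2 adjugate2_def)

text \<open>Conjugation by \<open>S_mat\<close> exchanges upper and lower triangular matrices and
  changes the sign of the off-diagonal entry.\<close>

lemma lower_in_E:
  assumes "algebraic_int x"
  shows "mat2 1 0 x 1 \<in> E"
proof -
  have "S_mat ** T_mat (- x) ** mat2 0 (- 1) 1 0 \<in> E"
    using assms by (intro subgroup_mult[OF subgroup_E] generate.incl T_mat_in_E S_inverse_in_E) auto
  then show ?thesis by (simp add: S_mat_mat2 T_mat_mat2 mat2_mult)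
qed

end

context modulus
begin

section \<open>Cosets of congruence subgroups\<close>

definition entries :: "'a ^ 2 ^ 2 \<Rightarrow> 'a \<times> 'a \<times> 'a \<times> 'a" where
  "entries A = (\<rho> (A $ 1 $ 1), \<rho> (A $ 1 $ 2), \<rho> (A $ 2 $ 1), \<rho> (A $ 2 $ 2))"

lemma entries_eq_iff:
  assumes "A \<in> carrier \<Gamma>" "B \<in> carrier \<Gamma>"
  shows "entries A = entries B \<longleftrightarrow>
    A $ 1 $ 1 - B $ 1 $ 1 \<in> I \<and> A $ 1 $ 2 - B $ 1 $ 2 \<in> I \<and>
    A $ 2 $ 1 - B $ 2 $ 1 \<in> I \<and> A $ 2 $ 2 - B $ 2 $ 2 \<in> I"
  using assms by (simp add: entries_def SL2_integers_carrier rep_eq_iff[OF I])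

lemma ideal_lincomb2:
  "algebraic_int x \<Longrightarrow> algebraic_int y \<Longrightarrow> u \<in> I \<Longrightarrow> v \<in> I \<Longrightarrow> u * x + v * y \<in> I"
  using ideal_add[OF I ideal_mult'[OF I] ideal_mult'[OF I]] .

text \<open>\<open>B ** adjugate2 A\<close> is the identity modulo \<open>I\<close> exactly when
  \<open>A\<close> and \<open>B\<close> agree modulo \<open>I\<close>. A general subgroup
  \<open>H\<close> covers the full and the elementary group at once.\<close>

lemma congruence_coset:
  assumes H: "subgroup H \<Gamma>" and A: "A \<in> H"
  shows "congruence_subgroup (\<Gamma>\<lparr>carrier := H\<rparr>) I #>\<^bsub>\<Gamma>\<lparr>carrier := H\<rparr>\<^esub> A = {B \<in> H. entries B = entries A}"
    (is "?C #>\<^bsub>?G\<^esub> A = ?R")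
proof -
  have HG: "B \<in> carrier \<Gamma>" if "B \<in> H" for B using subgroup.mem_carrier[OF H that] .
  have A': "A \<in> carrier \<Gamma>" using HG[OF A] .
  then have intA: "algebraic_int (A $ 1 $ 1)" "algebraic_int (A $ 1 $ 2)" "algebraic_int (A $ 2 $ 1)"
    "algebraic_int (A $ 2 $ 2)" and detA: "A $ 1 $ 1 * A $ 2 $ 2 - A $ 1 $ 2 * A $ 2 $ 1 = 1"
    by (simp_all add: SL2_integers_carrier det_2)
  have coset: "?C #>\<^bsub>?G\<^esub> A = (\<lambda>C. C ** A) ` ?C"
    by (auto simp: r_coset_def)
  show ?thesis
    unfolding coset
  proof (intro equalityI subsetI)
    fix B assume "B \<in> (\<lambda>C. C ** A) ` ?C"
    then obtain C where C: "C \<in> H" "C $ 1 $ 1 - 1 \<in> I" "C $ 2 $ 2 - 1 \<in> I" "C $ 1 $ 2 \<in> I" "C $ 2 $ 1 \<in> I"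
      and B: "B = C ** A"
      by (auto simp: congruence_subgroup_def)
    have "B \<in> H" using subgroup_mult[OF H C(1) A] B by simp
    moreover have "B $ 1 $ j - A $ 1 $ j = (C $ 1 $ 1 - 1) * A $ 1 $ j + C $ 1 $ 2 * A $ 2 $ j"
      "B $ 2 $ j - A $ 2 $ j = C $ 2 $ 1 * A $ 1 $ j + (C $ 2 $ 2 - 1) * A $ 2 $ j" for j
      by (simp_all add: B matrix_mult_2_nth algebra_simps)
    ultimately show "B \<in> ?R"
      using C intA by (simp add: entries_eq_iff[OF HG A'] ideal_lincomb2)
  next
    fix B assume "B \<in> ?R"
    then have "B \<in> H" "entries B = entries A" by auto
    then have B: "B \<in> H" "B $ 1 $ 1 - A $ 1 $ 1 \<in> I" "B $ 1 $ 2 - A $ 1 $ 2 \<in> I"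
      "B $ 2 $ 1 - A $ 2 $ 1 \<in> I" "B $ 2 $ 2 - A $ 2 $ 2 \<in> I"
      using entries_eq_iff[OF HG A', of B] by simp_all
    let ?D = "B ** adjugate2 A"
    have "B = ?D ** A"
      using adjugate2_mult[of A] A' by (simp add: SL2_integers_carrier flip: matrix_mul_assoc)
    moreover have "?D \<in> H"
      using subgroup_mult[OF H B(1) subgroup_adjugate2[OF H A]] .
    \<comment> \<open>With \<open>1\<close> rewritten as the determinant of \<open>A\<close>, each
      entry of \<open>?D\<close> minus the identity is a combination of entries of
      \<open>B - A\<close>.\<close>
    moreover have "?D $ 1 $ 1 - 1 = (B $ 1 $ 1 - A $ 1 $ 1) * A $ 2 $ 2 + (B $ 1 $ 2 - A $ 1 $ 2) * (- A $ 2 $ 1)"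
      "?D $ 1 $ 2 = (B $ 1 $ 1 - A $ 1 $ 1) * (- A $ 1 $ 2) + (B $ 1 $ 2 - A $ 1 $ 2) * A $ 1 $ 1"
      "?D $ 2 $ 1 = (B $ 2 $ 1 - A $ 2 $ 1) * A $ 2 $ 2 + (B $ 2 $ 2 - A $ 2 $ 2) * (- A $ 2 $ 1)"
      "?D $ 2 $ 2 - 1 = (B $ 2 $ 1 - A $ 2 $ 1) * (- A $ 1 $ 2) + (B $ 2 $ 2 - A $ 2 $ 2) * A $ 1 $ 1"
      unfolding detA[symmetric] by (simp_all add: matrix_mult_2_nth adjugate2_def algebra_simps)
    then have "?D $ 1 $ 1 - 1 \<in> I" "?D $ 1 $ 2 \<in> I" "?D $ 2 $ 1 \<in> I" "?D $ 2 $ 2 - 1 \<in> I"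
      using B intA by (simp_all only: ideal_lincomb2 algebraic_int_minus_iff)
    ultimately have "?D \<in> ?C" by (simp add: congruence_subgroup_def)
    then show "B \<in> (\<lambda>C. C ** A) ` ?C" using \<open>B = ?D ** A\<close> by (rule rev_image_eqI)
  qed
qed

lemma group_index_congruence_subgroup:
  assumes H: "subgroup H \<Gamma>"
  shows "group_index (\<Gamma>\<lparr>carrier := H\<rparr>) (congruence_subgroup (\<Gamma>\<lparr>carrier := H\<rparr>) I) = card (entries ` H)"
proof -
  let ?f = "\<lambda>A. {B \<in> H. entries B = entries A}"
  have "rcosets\<^bsub>\<Gamma>\<lparr>carrier := H\<rparr>\<^esub> congruence_subgroup (\<Gamma>\<lparr>carrier := H\<rparr>) I = ?f ` H"
    using congruence_coset[OF H] by (auto simp: RCOSETS_def)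
  moreover have "card (?f ` H) = card (entries ` H)"
    by (rule card_image_eqI) auto
  ultimately show ?thesis by (simp add: group_index_def)
qed

lemma entries_SL2_residues:
  assumes "A \<in> carrier \<Gamma>"
  shows "entries A \<in> SL2_residues"
proof -
  obtain a b c d where A: "A = mat2 a b c d"
    by (metis mat2_eqI mat2_nth)
  have int: "algebraic_int a" "algebraic_int b" "algebraic_int c" "algebraic_int d" and det: "a * d - b * c = 1"
    using assms by (simp_all add: SL2_integers_carrier det_2 A)
  have "\<rho> a * \<rho> d - \<rho> b * \<rho> c - 1 =
      ((\<rho> a - a) * \<rho> d + (\<rho> d - d) * a) - ((\<rho> b - b) * \<rho> c + (\<rho> c - c) * b)"
    unfolding det[symmetric] by (simp add: algebra_simps)
  also have "\<dots> \<in> I"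
    by (rule ideal_diff[OF I]; rule ideal_lincomb2) (use int rep_diff[OF I] I in auto)
  finally show ?thesis
    using int by (simp add: entries_def SL2_residues_def A rep_in_reps)
qed

section \<open>Surjectivity of reduction on the elementary group\<close>

text \<open>Primes are treated one at a time. If \<open>a + t * b\<close> lies in the new
  \<open>P\<close>, then \<open>b\<close> does not, and raising \<open>t\<close> by an element that
  is \<open>1\<close> modulo \<open>P\<close> and \<open>0\<close> modulo the earlier primes repairs
  \<open>P\<close> without harming them.\<close>

lemma stable_rank_one:
  assumes a: "algebraic_int a" and b: "algebraic_int b"
    and "S \<subseteq> primes_over" and "\<forall>P\<in>S. \<not> (a \<in> P \<and> b \<in> P)"
  shows "\<exists>t. algebraic_int t \<and> (\<forall>P\<in>S. a + t * b \<notin> P)"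
proof -
  have "finite S" using assms(3) finite_primes_over finite_subset by blast
  then show ?thesis using assms(3,4)
  proof (induction S)
    case empty
    then show ?case using algebraic_int_1 by blast
  next
    case (insert P S)
    then obtain t where t: "algebraic_int t" "\<forall>Q\<in>S. a + t * b \<notin> Q" by auto
    have P: "P \<in> primes_over" using insert by auto
    note P_ideal = primes_over_ideal[OF P]
    show ?case
    proof (cases "a + t * b \<in> P")
      case True
      have "b \<notin> P"
      proof
        assume "b \<in> P"
        then have "a + t * b - t * b \<in> P"
          using ideal_diff[OF P_ideal True ideal_mult[OF P_ideal t(1)]] by blast
        then show False using \<open>b \<in> P\<close> insert.prems by auto
      qed
      obtain e where e: "algebraic_int e" "e - 1 \<in> P" "\<And>Q. Q \<in> S \<Longrightarrow> e \<in> Q"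
        using primes_over_separate[OF P insert(1) _ insert(2)] insert.prems by blast
      have "a + (t + e) * b \<notin> P"
      proof
        assume "a + (t + e) * b \<in> P"
        then have "a + (t + e) * b - (a + t * b) - (e - 1) * b \<in> P"
          using ideal_diff[OF P_ideal ideal_diff[OF P_ideal _ True] ideal_mult'[OF P_ideal b e(2)]] by blast
        then show False using \<open>b \<notin> P\<close> by (simp add: algebra_simps)
      qed
      moreover have "a + (t + e) * b \<notin> Q" if Q: "Q \<in> S" for Q
      proof
        assume "a + (t + e) * b \<in> Q"
        moreover have "ideal Q R" using Q insert.prems primes_over_ideal by auto
        ultimately have "a + (t + e) * b - e * b \<in> Q"
          using ideal_diff ideal_mult' b e(3)[OF Q] by blast
        then show False using t(2) Q by (simp add: algebra_simps)
      qed
      ultimately show ?thesis using t(1) e(1) by (intro exI[of _ "t + e"]) auto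
    qed (use t in auto)
  qed
qed

text \<open>Gaussian elimination modulo \<open>I\<close>: a column operation makes the upper left
  entry a unit, which then serves as pivot; the remaining diagonal matrix is itself a product of
  elementary ones.\<close>

lemma SL2_residues_subset_entries_E: "SL2_residues \<subseteq> entries ` E"
proof
  fix z assume "z \<in> SL2_residues"
  then obtain a b c d where z: "z = (a, b, c, d)" and X: "a \<in> X" "b \<in> X" "c \<in> X" "d \<in> X"
    and det: "a * d - b * c - 1 \<in> I" by (auto simp: SL2_residues_def)
  have int: "algebraic_int a" "algebraic_int b" "algebraic_int c" "algebraic_int d"
    using X by blast+
  have "unimodular a b" using int det by (auto simp: unimodular_def)
  then obtain t where t: "algebraic_int t" "\<forall>P\<in>primes_over. a + t * b \<notin> P"
    using stable_rank_one[of a b primes_over] int by (auto simp: unimodular_iff)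
  define x y where "x = a + t * b" and "y = c + t * d"
  have xy: "algebraic_int x" "algebraic_int y" using int t by (auto simp: x_def y_def)
  \<comment> \<open>The criterion for the pair \<open>(x, x)\<close> says that \<open>x\<close> lies
    in no prime above \<open>I\<close>; the resulting \<open>s = v - u\<close> is an inverse of
    \<open>x\<close> modulo \<open>I\<close>.\<close>
  have "unimodular x x" using t(2) xy by (simp add: unimodular_iff) (simp add: x_def)
  then obtain u v where uv: "algebraic_int u" "algebraic_int v" "x * v - x * u - 1 \<in> I"
    by (auto simp: unimodular_def)
  define s where "s = v - u"
  \<comment> \<open>\<open>\<epsilon>\<close> and \<open>\<delta>\<close> record the errors in
    \<open>x * s = 1\<close> and in the determinant, so that the congruences for \<open>?M\<close>
    become exact polynomial identities.\<close>
  define \<epsilon> where "\<epsilon> = 1 - x * s"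
  define \<delta> where "\<delta> = x * d - b * y - 1"
  have s: "algebraic_int s" using uv by (auto simp: s_def)
  have "- (x * v - x * u - 1) \<in> I" using ideal_uminus[OF I uv(3)] .
  then have \<epsilon>: "\<epsilon> \<in> I" by (simp add: \<epsilon>_def s_def algebra_simps)
  have \<delta>: "\<delta> \<in> I" using det by (simp add: \<delta>_def x_def y_def algebra_simps)
  \<comment> \<open>Modulo \<open>I\<close>, the bracketed factor is \<open>diag(x, s)\<close>, the factors around it turn it into \<open>(x, b; y, d)\<close>,
    and the last factor undoes the column operation that made \<open>x\<close> a unit.\<close>
  let ?M = "mat2 1 0 (y * s) 1 ** (T_mat x ** mat2 1 0 (- s) 1 ** T_mat x ** mat2 0 (- 1) 1 0) **
    T_mat (s * b) ** mat2 1 0 (- t) 1"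
  have M: "?M \<in> E"
    using xy s int t
    by (intro subgroup_mult[OF subgroup_E] lower_in_E T_mat_in_E S_inverse_in_E) auto
  \<comment> \<open>In each row the second column comes first: the final factor subtracts
    \<open>t\<close> times it from the first column, whose error therefore involves it. The summand
    \<open>\<epsilon> * 0\<close> only fits the two-term shape of
    \<open>ideal_lincomb2\<close>.\<close>
  have "?M $ 1 $ 2 - b = \<epsilon> * (x * s * b - 1 - b) + \<epsilon> * 0"
    by (simp add: T_mat_mat2 mat2_mult \<epsilon>_def algebra_simps)
  also have "\<dots> \<in> I" using \<epsilon> xy s int by (intro ideal_lincomb2) auto
  finally have M12: "?M $ 1 $ 2 - b \<in> I" .
  have "?M $ 1 $ 1 - a = \<epsilon> * x + (?M $ 1 $ 2 - b) * (- t)"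
    by (simp add: T_mat_mat2 mat2_mult \<epsilon>_def x_def algebra_simps)
  also have "\<dots> \<in> I" using \<epsilon> M12 xy t by (intro ideal_lincomb2) auto
  finally have M11: "?M $ 1 $ 1 - a \<in> I" .
  have "?M $ 2 $ 2 - d = (\<epsilon> * (s * b - d) + \<delta> * (- s)) + (?M $ 1 $ 2 - b) * (y * s)"
    by (simp add: T_mat_mat2 mat2_mult \<epsilon>_def \<delta>_def algebra_simps)
  also have "\<dots> \<in> I" using \<epsilon> \<delta> M12 xy s int
    by (intro ideal_add[OF I ideal_lincomb2 ideal_mult'[OF I]]) auto
  finally have M22: "?M $ 2 $ 2 - d \<in> I" .
  have "?M $ 2 $ 1 - c = \<epsilon> * (1 + y * s * x - y) + (?M $ 2 $ 2 - d) * (- t)"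
    by (simp add: T_mat_mat2 mat2_mult \<epsilon>_def y_def algebra_simps)
  also have "\<dots> \<in> I" using \<epsilon> M22 xy s t by (intro ideal_lincomb2) auto
  finally have M21: "?M $ 2 $ 1 - c \<in> I" .
  have "?M \<in> carrier \<Gamma>" using subgroup.mem_carrier[OF subgroup_E M] .
  then have "entries ?M = (\<rho> a, \<rho> b, \<rho> c, \<rho> d)"
    using int M11 M12 M21 M22
    by (simp only: entries_def SL2_integers_carrier rep_eq_iff[OF I] prod.inject)
  then have "entries ?M = z" using X by (simp add: z rep_reps[OF I])
  then show "z \<in> entries ` E" using M by blast
qed

text \<open>The elementary group already attains every residue matrix, and the full group attains no
  others.\<close>

lemma entries_image:
  assumes "subgroup H \<Gamma>" and "E \<subseteq> H"
  shows "entries ` H = SL2_residues"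
  using entries_SL2_residues subgroup.mem_carrier[OF assms(1)] SL2_residues_subset_entries_E assms(2)
  by blast

lemma primes_over_eq: "primes_over = {P. primeideal P R \<and> ideal_dvd P I}"
  using prime_ideal_dvd[OF _ I I_nonzero] ideal_dvd_imp_subset[OF primeideal.axioms(1)]
  by (auto simp: primes_over_def)

end

theorem theorem2p6:
  fixes W :: "'a :: field_char_0 set" and \<pi> :: "'a set"
  assumes "number_field TYPE('a)"
    and "integral_basis W" and "1 \<in> W"
    and "ideal \<pi> ring_of_integers"
    and "\<pi> \<noteq> {0}" and "\<pi> \<noteq> carrier ring_of_integers"
  shows "group_index SL2_integers (congruence_subgroup SL2_integers \<pi>) =
           group_index (elementary_group W) (congruence_subgroup (elementary_group W) \<pi>) \<and>
         real (group_index (elementary_group W) (congruence_subgroup (elementary_group W) \<pi>)) =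
           real (ideal_norm \<pi>) ^ 3 *
           (\<Prod>P | primeideal P ring_of_integers \<and> ideal_dvd P \<pi>.
              1 - 1 / real (ideal_norm P) ^ 2)"
proof -
  interpret modulus W \<pi>
    using assms by (intro modulus.intro number_ring.intro modulus_axioms.intro) (auto intro: ideal.axioms(2))
  \<comment> \<open>The full group is the case where \<open>H\<close> is the whole carrier.\<close>
  have "group_index SL2_integers (congruence_subgroup SL2_integers \<pi>) = card SL2_residues"
    using group_index_congruence_subgroup[OF group.subgroup_self[OF group_SL2_integers]]
      entries_image[OF group.subgroup_self[OF group_SL2_integers] subgroup.subset[OF subgroup_E]]
    by simp
  moreover have "group_index (elementary_group W) (congruence_subgroup (elementary_group W) \<pi>) =
      card SL2_residues"
    using group_index_congruence_subgroup[OF subgroup_E] entries_image[OF subgroup_E]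
    by (simp add: elementary_group_def)
  ultimately show ?thesis
    using card_SL2_residues by (simp add: primes_over_eq)
qed

end
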